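(* For $1\leq p<\infty$, $-1<a<p-1$, and any nonnegative (measurable) $f\colon[0,\infty)\to[0,\infty)$, $$A_{p,a}^{-p}\int_0^\infty|Hf(t)|^pt^a\,dt\leq\int_0^\infty|H^*f(t)|^pt^a\,dt\leq A_{p,p-2-a}^p\int_0^\infty|Hf(t)|^pt^a\,dt.$$ The constants are best possible, i.e. for given $p,a$ the constant $A_{p,a}^{-p}$ cannot be replaced by a larger one and $A_{p,p-2-a}^p$ cannot be replaced by a smaller one.
   Context: For nonnegative measurable $f$ on $[0,\infty)$, $Hf(t)=\frac1t\int_0^tf(s)\,ds$ and $H^*f(t)=\int_t^\infty\frac{f(s)}{s}\,ds$ for $t>0$ (with values in $[0,\infty]$). For $1\le p<\infty$ and $-1<a<p-1$, $A_{p,a}$ denotes the smallest constant $K$ such that $$\int_0^\infty|H\varphi(t)-\varphi(t)|^p t^a\,dt\le K^p\int_0^\infty|\varphi(t)|^pt^a\,dt$$ for all positive and decreasing functions $\varphi$ on the half-line for which the right-hand side is finite, where "positive" means $\varphi\ge0$ and "decreasing" means non-increasing on $(0,\infty)$ (the value at $t=0$ is irrelevant). Note that $-1<a<p-1$ implies $-1<p-2-a<p-1$, so $A_{p,p-2-a}$ is defined. *)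

theory Defs
  imports "HOL-Analysis.Analysis"
begin

definition hardy_avg :: "(real \<Rightarrow> real) \<Rightarrow> real \<Rightarrow> ennreal" where
  "hardy_avg f t = ennreal (1 / t) * (\<integral>\<^sup>+s\<in>{0..t}. ennreal (f s) \<partial>lebesgue)"

definition hardy_dual :: "(real \<Rightarrow> real) \<Rightarrow> real \<Rightarrow> ennreal" where
  "hardy_dual f t = (\<integral>\<^sup>+s\<in>{t..}. ennreal (f s / s) \<partial>lebesgue)"

(* x^p for x in [0,\<infinity>] and p > 0, with \<infinity>^p = \<infinity>; HOL-Analysis has no real powers on ennreal. *)
definition ennreal_rpow :: "ennreal \<Rightarrow> real \<Rightarrow> ennreal" where
  "ennreal_rpow x p = (if x = \<infinity> then \<infinity> else ennreal (enn2real x powr p))"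

definition weighted_power_integral :: "real \<Rightarrow> real \<Rightarrow> (real \<Rightarrow> ennreal) \<Rightarrow> ennreal" where
  "weighted_power_integral p a g =
     (\<integral>\<^sup>+t\<in>{0<..}. ennreal_rpow (g t) p * ennreal (t powr a) \<partial>lebesgue)"

(* On the left, enn2real loses nothing: for p \<ge> 1 and -1 < a < p - 1, finiteness of
   weighted_power_integral p a \<phi> forces \<phi> t = O(t powr (-(a + 1) / p)) with (a + 1) / p < 1,
   so that hardy_avg \<phi> t < \<infinity> for all t > 0. *)
definition hardy_diff_bound :: "real \<Rightarrow> real \<Rightarrow> real \<Rightarrow> bool" where
  "hardy_diff_bound p a K \<longleftrightarrow>
     (\<forall>\<phi> :: real \<Rightarrow> real.
        (\<forall>t>0. 0 \<le> \<phi> t) \<longrightarrow> antimono_on {0<..} \<phi> \<longrightarrow>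
        weighted_power_integral p a (\<lambda>t. ennreal (\<phi> t)) < \<infinity> \<longrightarrow>
        weighted_power_integral p a (\<lambda>t. ennreal \<bar>enn2real (hardy_avg \<phi> t) - \<phi> t\<bar>)
          \<le> ennreal (K powr p) * weighted_power_integral p a (\<lambda>t. ennreal (\<phi> t)))"

(* K \<ge> 0 is required because powr is not the intended power for a negative base. *)
definition hardy_const :: "real \<Rightarrow> real \<Rightarrow> real" where
  "hardy_const p a = (LEAST K. 0 \<le> K \<and> hardy_diff_bound p a K)"

definition nonneg_measurable :: "(real \<Rightarrow> real) \<Rightarrow> bool" where
  "nonneg_measurable f \<longleftrightarrow>
     f \<in> borel_measurable (lebesgue_on {0..}) \<and> (\<forall>s\<ge>0. 0 \<le> f s)"

end

theory Submission
  imports Defs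
begin

text \<open>For \<open>\<phi> = H\<^sup>*f\<close> Tonelli's theorem gives \<open>H\<phi> = Hf + H\<^sup>*f\<close>, so the left inequality is the
  defining inequality of \<open>A\<^sub>p\<^sub>,\<^sub>a\<close> applied to the decreasing function \<open>\<phi>\<close>. The substitution
  \<open>t \<mapsto> 1/t\<close> interchanges \<open>H\<close> and \<open>H\<^sup>*\<close> and replaces \<open>a\<close> by \<open>p - 2 - a\<close>, which yields the right
  inequality.

  Conversely, for a decreasing \<open>\<phi>\<close> and \<open>l > 1\<close> put \<open>f s = \<phi> s - \<phi> (l s)\<close>. Then
  \<open>Hf \<ge> (1 - 1/l)(H\<phi> - \<phi>)\<close> and \<open>H\<^sup>*f \<le> (l - 1) \<phi>\<close>, so a constant that works for all \<open>f\<close> works,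
  up to the factor \<open>l\<^sup>p\<close>, for all \<open>\<phi>\<close>; let \<open>l\<close> tend to \<open>1\<close>.\<close>

subsection \<open>Powers and integrals over the half-line\<close>

text \<open>The dilation difference imitates a derivative. For smooth decreasing
  \<open>\<phi>\<close> with suitable behaviour at \<open>0\<close> and at infinity, the function
  \<open>f s = - s * \<phi>' s\<close> satisfies \<open>H* f = \<phi>\<close> and, after integration
  by parts, \<open>H f = H \<phi> - \<phi>\<close>; then the bound for \<open>f\<close> is literally
  the bound for \<open>\<phi>\<close>. A decreasing function need not be differentiable, so a
  multiplicative difference quotient takes the place of the derivative; the norming factor
  \<open>l - 1\<close> is left out, since only the ratio of the two sides counts. Two obstacles
  account for most of the remaining work. The difference \<open>H \<phi> - \<phi>\<close> is taken
  between real numbers while all other quantities live in \<open>[0, \<infinity>]\<close>, so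
  finiteness at each point has to be known before anything is subtracted. And the best constant is a
  \<open>LEAST\<close> over the reals, which has the intended meaning only once the admissible
  constants are known to be nonempty and to contain their infimum; that infimum must also be
  positive for its negative power to be the reciprocal of the positive one.\<close>

lemma ennreal_rpow_ennreal: "0 \<le> x \<Longrightarrow> ennreal_rpow (ennreal x) p = ennreal (x powr p)"
  by (simp add: ennreal_rpow_def)

lemma ennreal_rpow_mono:
  assumes "0 \<le> p" "x \<le> y"
  shows "ennreal_rpow x p \<le> ennreal_rpow y p"
  using assms
  by (cases x; cases y) (auto simp: ennreal_rpow_def top_unique intro!: ennreal_leI powr_mono2)

lemma ennreal_rpow_cmult:
  assumes "0 < c"
  shows "ennreal_rpow (ennreal c * x) p = ennreal (c powr p) * ennreal_rpow x p"
  using assms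
  by (cases x) (auto simp: ennreal_rpow_def ennreal_mult_top powr_mult ennreal_mult[symmetric])

lemma measurable_ennreal_rpow [measurable]: "(\<lambda>x. ennreal_rpow x p) \<in> borel_measurable borel"
  unfolding ennreal_rpow_def by measurable

text \<open>The nonnegative integral is a supremum over simple functions below the integrand, and
  completing the measure leaves it unchanged for every integrand. This moves all computations to
  \<open>lborel\<close>, where Tonelli's theorem and substitutions are applied.\<close>

lemma hardy_avg_lborel: "hardy_avg f t = ennreal (1 / t) * (\<integral>\<^sup>+s\<in>{0..t}. ennreal (f s) \<partial>lborel)"
  by (simp add: hardy_avg_def nn_integral_completion)

lemma hardy_dual_lborel: "hardy_dual f t = (\<integral>\<^sup>+s\<in>{t..}. ennreal (f s / s) \<partial>lborel)"
  by (simp add: hardy_dual_def nn_integral_completion)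

lemma weighted_power_integral_lborel: "weighted_power_integral p a g =
    (\<integral>\<^sup>+t\<in>{0<..}. ennreal_rpow (g t) p * ennreal (t powr a) \<partial>lborel)"
  by (simp add: weighted_power_integral_def nn_integral_completion)

lemma measurable_hardy_avg [measurable]:
  assumes [measurable]: "f \<in> borel_measurable borel"
  shows "hardy_avg f \<in> borel_measurable borel"
proof -
  \<comment> \<open>With the moving interval written as a kernel in \<open>s\<close> and
    \<open>t\<close>, the integrand is jointly measurable, and measurability of a parametrised
    integral applies.\<close>
  have "(\<lambda>t. ennreal (1 / t) * (\<integral>\<^sup>+s. ennreal (f s) * (if 0 \<le> s \<and> s \<le> t then 1 else 0) \<partial>lborel))
    \<in> borel_measurable borel"
    by measurable
  then show ?thesis
    by (rule measurable_cong[THEN iffD1, rotated])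
       (auto simp: hardy_avg_lborel indicator_def intro!: arg_cong2[where f = "(*)"] nn_integral_cong)
qed

lemma measurable_hardy_dual [measurable]:
  assumes [measurable]: "f \<in> borel_measurable borel"
  shows "hardy_dual f \<in> borel_measurable borel"
proof -
  have "(\<lambda>t. \<integral>\<^sup>+s. ennreal (f s / s) * (if t \<le> s then 1 else 0) \<partial>lborel) \<in> borel_measurable borel"
    by measurable
  then show ?thesis
    by (rule measurable_cong[THEN iffD1, rotated])
       (auto simp: hardy_dual_lborel indicator_def intro!: nn_integral_cong)
qed

lemma weighted_power_integral_mono:
  assumes "0 \<le> p" "\<And>t. 0 < t \<Longrightarrow> g t \<le> h t"
  shows "weighted_power_integral p a g \<le> weighted_power_integral p a h"
  unfolding weighted_power_integral_def using assms
  by (intro nn_integral_mono) (auto split: split_indicator intro!: mult_right_mono ennreal_rpow_mono)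

lemma weighted_power_integral_cong:
  assumes "\<And>t. 0 < t \<Longrightarrow> g t = h t"
  shows "weighted_power_integral p a g = weighted_power_integral p a h"
  unfolding weighted_power_integral_def using assms
  by (intro nn_integral_cong) (auto split: split_indicator)

lemma weighted_power_integral_cmult:
  assumes "0 < c" and [measurable]: "g \<in> borel_measurable borel"
  shows "weighted_power_integral p a (\<lambda>t. ennreal c * g t) =
    ennreal (c powr p) * weighted_power_integral p a g"
  unfolding weighted_power_integral_lborel
  by (subst nn_integral_cmult[symmetric]) (auto simp: ennreal_rpow_cmult[OF assms(1)] mult_ac)

text \<open>Passing to a Borel representative makes Tonelli's theorem available on \<open>lborel\<close>.\<close>

lemma nonneg_measurable_borel_rep:
  assumes "nonneg_measurable f"
  obtains g where "g \<in> borel_measurable borel" "\<And>s. 0 \<le> g s"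
    "hardy_avg f = hardy_avg g" "\<And>t. 0 < t \<Longrightarrow> hardy_dual f t = hardy_dual g t"
proof -
  \<comment> \<open>Nothing is known about \<open>f\<close> at negative arguments, so it is replaced
    by zero there. A value of \<open>hardy_dual\<close> at negative \<open>t\<close> would notice
    this, hence the restriction to positive \<open>t\<close> in the conclusion.\<close>
  have "(\<lambda>x. if x \<in> {0..} then f x else 0) \<in> borel_measurable lebesgue"
    using assms unfolding nonneg_measurable_def by (intro borel_measurable_if_I) auto
  then obtain g where g [measurable]: "g \<in> borel_measurable lborel"
    and ae: "AE x in lborel. (if x \<in> {0..} then f x else 0) = g x"
    using completion_ex_borel_measurable_real by blast
  have pos: "0 \<le> f s" if "0 \<le> s" for s
    using assms that by (auto simp: nonneg_measurable_def)
  \<comment> \<open>\<open>g\<close> is nonnegative only almost everywhere; the maximum with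
    \<open>0\<close> repairs this on a null set.\<close>
  show thesis
  proof (rule that[of "\<lambda>x. max 0 (g x)"])
    show "(\<lambda>x. max 0 (g x)) \<in> borel_measurable borel"
      using g by simp
    show "hardy_avg f = hardy_avg (\<lambda>x. max 0 (g x))"
      unfolding hardy_avg_lborel fun_eq_iff
    proof (intro allI arg_cong2[where f = "(*)"] refl nn_integral_cong_AE)
      fix t
      show "AE x in lborel. ennreal (f x) * indicator {0..t} x
              = ennreal (max 0 (g x)) * indicator {0..t} x"
        using ae
      proof eventually_elim
        case (elim x)
        then show ?case using pos[of x] by (cases "0 \<le> x") (auto simp: max_def)
      qed
    qed
    show "hardy_dual f t = hardy_dual (\<lambda>x. max 0 (g x)) t" if "0 < t" for t
      unfolding hardy_dual_lborel
    proof (intro nn_integral_cong_AE)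
      show "AE x in lborel. ennreal (f x / x) * indicator {t..} x
              = ennreal (max 0 (g x) / x) * indicator {t..} x"
        using ae
      proof eventually_elim
        case (elim x)
        then show ?case using pos[of x] that by (cases "0 \<le> x") (auto simp: max_def)
      qed
    qed
  qed auto
qed

lemma borel_nonneg_measurable:
  assumes "f \<in> borel_measurable borel" "\<And>s. 0 \<le> f s"
  shows "nonneg_measurable f"
  using assms unfolding nonneg_measurable_def
  by (auto intro!: measurable_restrict_space1 measurable_completion)

section \<open>Integrals of powers, and the substitution of the reciprocal\<close>

lemma nn_integral_powr_from_0:
  assumes "-1 < a" "0 \<le> c"
  shows "(\<integral>\<^sup>+x\<in>{0..c}. ennreal (x powr a) \<partial>lborel) = ennreal (c powr (a + 1) / (a + 1))"
  using nn_integral_has_integral_lebesgue'[OF _ has_integral_powr_from_0[OF assms]] by simp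

lemma nn_integral_powr_to_inf:
  assumes "a < -1" "0 < c"
  shows "(\<integral>\<^sup>+x\<in>{c..}. ennreal (x powr a) \<partial>lborel) = ennreal (c powr (a + 1) / (- a - 1))"
proof -
  have "(\<integral>\<^sup>+x\<in>{c..}. ennreal (x powr a) \<partial>lborel) = ennreal (-(c powr (a + 1)) / (a + 1))"
    using nn_integral_has_integral_lebesgue'[OF _ has_integral_powr_to_inf[OF assms]] by simp
  also have "-(c powr (a + 1)) / (a + 1) = c powr (a + 1) / (- a - 1)"
    using assms by (simp add: field_simps)
  finally show ?thesis .
qed

lemma nn_integral_const_Icc:
  assumes "x \<le> y" "0 \<le> c"
  shows "(\<integral>\<^sup>+s\<in>{x..y}. ennreal c \<partial>lborel) = ennreal (c * (y - x))"
  using assms by (simp add: nn_integral_cmult_indicator ennreal_mult)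

text \<open>The substitution theorem of the library covers real functions on compact intervals only, so
  \<open>F\<close> is truncated at height \<open>n\<close> and to the interval \<open>{1/(n+1)..n+1}\<close>.\<close>

lemma nn_integral_inverse:
  fixes F :: "real \<Rightarrow> ennreal"
  assumes [measurable]: "F \<in> borel_measurable borel"
  shows "(\<integral>\<^sup>+x\<in>{0<..}. F x \<partial>lborel) = (\<integral>\<^sup>+x\<in>{0<..}. F (1 / x) * ennreal (1 / x\<^sup>2) \<partial>lborel)"
proof -
  define G where "G n x = min (F x) (of_nat n)" for n :: nat and x
  define I where "I n = {1 / real (Suc n)..real (Suc n)}" for n
  have [measurable]: "G n \<in> borel_measurable borel" "I n \<in> sets borel" for n
    unfolding G_def[abs_def] I_def by measurable
  have G_real: "G n x = ennreal (enn2real (G n x))" for n x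
  proof -
    have "G n x \<le> of_nat n" by (simp add: G_def)
    also have "\<dots> < top" by (simp add: of_nat_less_top)
    finally show ?thesis by simp
  qed
  have inc_I: "I m \<subseteq> I n" if "m \<le> n" for m n
    using that unfolding I_def by (auto simp: field_simps frac_le order_trans[OF _ frac_le])
  \<comment> \<open>The argument \<open>x\<close> of \<open>G\<close> and the argument
    \<open>y\<close> of the indicator are kept apart because after the substitution they are
    \<open>1 / x\<close> and \<open>x\<close>.\<close>
  have inc: "G m x * indicator (I m) y \<le> G n x * indicator (I n) y" if "m \<le> n" for m n x y
    using inc_I[OF that] that unfolding G_def
    by (auto split: split_indicator simp: min.coboundedI2)
  have ex_I: "\<exists>n. x \<in> I n" if "0 < x" for x
  proof -
    obtain n where n: "max x (1 / x) < real n" using reals_Archimedean2 by blast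
    then have "x \<in> I n" using that unfolding I_def by (auto simp: field_simps)
    then show ?thesis ..
  qed
  have I_pos: "x \<in> I n \<Longrightarrow> 0 < x" for x n
    unfolding I_def by (auto intro: less_le_trans[of _ "1 / (1 + real n)"] simp: add_pos_nonneg)
  have sup: "(SUP n. G n x * indicator (I n) y) = F x * indicator {0<..} y" for x y
  proof (cases "0 < y")
    case True
    then obtain N where N: "y \<in> I N" using ex_I by blast
    have "(SUP n. G n x * indicator (I n) y) = F x"
    proof (rule antisym)
      show "(SUP n. G n x * indicator (I n) y) \<le> F x"
        by (auto intro!: SUP_least simp: G_def split: split_indicator)
      have "F x = (SUP n. G n x)"
      proof -
        have "(SUP n. min (F x) (of_nat n)) = inf (F x) (SUP n. of_nat n)"
          by (simp add: inf_SUP flip: inf_min)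
        then show ?thesis by (simp add: G_def ennreal_SUP_of_nat_eq_top)
      qed
      also have "\<dots> \<le> (SUP n. G n x * indicator (I n) y)"
      proof (rule SUP_least)
        fix n
        have "G n x \<le> G (max n N) x * indicator (I (max n N)) y"
          using inc_I[of N "max n N"] N by (auto simp: G_def min.coboundedI2)
        also have "\<dots> \<le> (SUP n. G n x * indicator (I n) y)"
          by (intro SUP_upper) auto
        finally show "G n x \<le> (SUP n. G n x * indicator (I n) y)" .
      qed
      finally show "F x \<le> (SUP n. G n x * indicator (I n) y)" .
    qed
    then show ?thesis using True by simp
  next
    case False
    then have "y \<notin> I n" for n using I_pos by blast
    then show ?thesis using False by simp
  qed
  \<comment> \<open>The interval \<open>I n\<close> is invariant under reciprocals, so the same
    indicator appears on both sides. Substitution needs a nonnegative derivative, while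
    \<open>1 / x\<close> decreases; so the integrand is first reflected at \<open>0\<close>, and
    then \<open>- (1 / x)\<close> is substituted.\<close>
  have *: "(\<integral>\<^sup>+x. G n x * indicator (I n) x \<partial>lborel)
      = (\<integral>\<^sup>+x. G n (1 / x) * indicator (I n) x * ennreal (1 / x\<^sup>2) \<partial>lborel)" for n
  proof -
    let ?f = "\<lambda>x. enn2real (G n (- x))"
    have "(\<integral>\<^sup>+x. G n x * indicator (I n) x \<partial>lborel)
        = (\<integral>\<^sup>+x. G n (- x) * indicator (I n) (- x) \<partial>lborel)"
      by (subst nn_integral_real_affine[where c = "-1" and t = 0]) auto
    \<comment> \<open>The left endpoint stays unsimplified: both endpoints must appear as values of
      \<open>- (1 / x)\<close> at the ends of \<open>I n\<close>.\<close>
    also have "\<dots> = (\<integral>\<^sup>+x. ?f x * indicator {-(1 / (1 / real (Suc n)))..-(1 / real (Suc n))} x \<partial>lborel)"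
      by (intro nn_integral_cong) (auto simp: I_def G_real[symmetric] split: split_indicator)
    also have "\<dots> = (\<integral>\<^sup>+x. ?f (-(1 / x)) * (1 / x\<^sup>2) * indicator {1 / real (Suc n)..real (Suc n)} x \<partial>lborel)"
    proof (rule nn_integral_substitution[where g = "\<lambda>x. -(1 / x)" and g' = "\<lambda>x. 1 / x\<^sup>2"])
      show "set_borel_measurable borel {- (1 / (1 / real (Suc n)))..- (1 / real (Suc n))} ?f"
        unfolding set_borel_measurable_def by measurable
      have p: "x \<noteq> 0" if "x \<in> {1 / real (Suc n)..real (Suc n)}" for x
        using I_pos[of x n] that by (auto simp: I_def)
      show "((\<lambda>x. - (1 / x)) has_real_derivative 1 / x\<^sup>2) (at x)"
        if "x \<in> {1 / real (Suc n)..real (Suc n)}" for x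
        using p[OF that] by (auto intro!: derivative_eq_intros simp: power2_eq_square)
      show "continuous_on {1 / real (Suc n)..real (Suc n)} (\<lambda>x. 1 / x\<^sup>2)"
        using p by (intro continuous_intros) auto
      show "1 / real (Suc n) \<le> real (Suc n)"
        by (simp add: field_simps)
    qed auto
    also have "\<dots> = (\<integral>\<^sup>+x. G n (1 / x) * indicator (I n) x * ennreal (1 / x\<^sup>2) \<partial>lborel)"
    proof (intro nn_integral_cong)
      fix x :: real
      show "ennreal (enn2real (G n (- (- (1 / x)))) * (1 / x\<^sup>2) *
            indicator {1 / real (Suc n)..real (Suc n)} x) =
            G n (1 / x) * indicator (I n) x * ennreal (1 / x\<^sup>2)"
      proof -
        have "ennreal (enn2real (G n (1 / x)) * (1 / x\<^sup>2)) = G n (1 / x) * ennreal (1 / x\<^sup>2)"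
          by (subst ennreal_mult, simp, simp, simp only: G_real[symmetric])
        then show ?thesis
          unfolding I_def by (cases "x \<in> {1 / real (Suc n)..real (Suc n)}") (simp_all del: of_nat_Suc)
      qed
    qed
    finally show ?thesis .
  qed
  have "(\<integral>\<^sup>+x\<in>{0<..}. F x \<partial>lborel) = (\<integral>\<^sup>+x. (SUP n. G n x * indicator (I n) x) \<partial>lborel)"
    by (simp add: sup)
  also have "\<dots> = (SUP n. \<integral>\<^sup>+x. G n x * indicator (I n) x \<partial>lborel)"
    by (intro nn_integral_monotone_convergence_SUP) (auto simp: incseq_def le_fun_def intro: inc)
  also have "\<dots> = (SUP n. \<integral>\<^sup>+x. G n (1 / x) * indicator (I n) x * ennreal (1 / x\<^sup>2) \<partial>lborel)"
    by (simp only: *)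
  also have "\<dots> = (\<integral>\<^sup>+x. (SUP n. G n (1 / x) * indicator (I n) x * ennreal (1 / x\<^sup>2)) \<partial>lborel)"
    by (intro nn_integral_monotone_convergence_SUP[symmetric])
       (auto simp: incseq_def le_fun_def intro!: mult_right_mono inc)
  also have "\<dots> = (\<integral>\<^sup>+x\<in>{0<..}. F (1 / x) * ennreal (1 / x\<^sup>2) \<partial>lborel)"
  proof (intro nn_integral_cong)
    fix x :: real
    have "(SUP n. G n (1 / x) * indicator (I n) x * ennreal (1 / x\<^sup>2))
        = (SUP n. G n (1 / x) * indicator (I n) x) * ennreal (1 / x\<^sup>2)"
      by (rule SUP_mult_right_ennreal[symmetric])
    also have "(SUP n. G n (1 / x) * indicator (I n) x) = F (1 / x) * indicator {0<..} x"
      by (rule sup)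
    finally show "(SUP n. G n (1 / x) * indicator (I n) x * ennreal (1 / x\<^sup>2))
        = F (1 / x) * ennreal (1 / x\<^sup>2) * indicator {0<..} x"
      by (simp only: mult_ac)
  qed
  finally show ?thesis .
qed

subsection \<open>Inversion\<close>

text \<open>On the positive half-line this is an involution. The Jacobian
  \<open>1 / s\<^sup>2\<close> of the substitution contributes one factor \<open>1 / s\<close> to
  the transform and one to the kernel of \<open>hardy_dual\<close>, which is why the two operators
  are interchanged. The absolute value keeps the transform of a nonnegative function nonnegative on
  the whole line.\<close>

definition inversion :: "(real \<Rightarrow> real) \<Rightarrow> real \<Rightarrow> real" where
  "inversion f u = f (1 / u) / \<bar>u\<bar>"

lemma measurable_inversion [measurable]:
  assumes [measurable]: "f \<in> borel_measurable borel"
  shows "inversion f \<in> borel_measurable borel"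
  unfolding inversion_def[abs_def] by measurable

lemma inversion_nonneg: "(\<And>s. 0 \<le> f s) \<Longrightarrow> 0 \<le> inversion f u"
  by (simp add: inversion_def)

lemma nn_integral_lborel_cong_finite:
  fixes f g :: "real \<Rightarrow> ennreal"
  assumes "finite A" "\<And>x. x \<notin> A \<Longrightarrow> f x = g x"
  shows "integral\<^sup>N lborel f = integral\<^sup>N lborel g"
proof (rule nn_integral_cong_AE)
  show "AE x in lborel. f x = g x"
    using AE_not_in[OF finite_imp_null_set_lborel[OF assms(1)]] by eventually_elim (rule assms(2))
qed

lemma hardy_avg_inverse:
  assumes [measurable]: "f \<in> borel_measurable borel" and "0 < t"
  shows "hardy_avg f (1 / t) = ennreal t * hardy_dual (inversion f) t"
proof -
  have "(\<integral>\<^sup>+s\<in>{0..1/t}. ennreal (f s) \<partial>lborel)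
      = (\<integral>\<^sup>+s\<in>{0<..}. (ennreal (f s) * indicator {0..1/t} s) \<partial>lborel)"
    by (rule nn_integral_lborel_cong_finite[of "{0}"])
       (simp_all split: split_indicator)
  also have "\<dots> = (\<integral>\<^sup>+s\<in>{0<..}. (ennreal (f (1 / s)) * indicator {0..1/t} (1 / s)) * ennreal (1 / s\<^sup>2) \<partial>lborel)"
    by (rule nn_integral_inverse[where F = "\<lambda>s. ennreal (f s) * indicator {0..1/t} s"]) measurable
  also have "\<dots> = (\<integral>\<^sup>+s\<in>{t..}. ennreal (inversion f s / s) \<partial>lborel)"
  proof (intro nn_integral_cong)
    fix s :: real
    have "ennreal (f (1 / s)) * ennreal (1 / s\<^sup>2) = ennreal (inversion f s / s)" if "0 < s"
      using that by (subst ennreal_mult''[symmetric]) (simp_all add: inversion_def power2_eq_square)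
    moreover have "1 / s \<le> 1 / t \<longleftrightarrow> t \<le> s" if "0 < s"
      using that assms(2) by (simp add: field_simps)
    ultimately show "ennreal (f (1 / s)) * indicator {0..1/t} (1 / s) * ennreal (1 / s\<^sup>2) * indicator {0<..} s
        = ennreal (inversion f s / s) * indicator {t..} s"
      using assms(2) by (auto split: split_indicator)
  qed
  finally show ?thesis
    by (simp add: hardy_avg_lborel hardy_dual_lborel)
qed

lemma hardy_dual_inverse:
  assumes [measurable]: "f \<in> borel_measurable borel" and "0 < t"
  shows "hardy_dual f (1 / t) = ennreal t * hardy_avg (inversion f) t"
proof -
  have "(\<integral>\<^sup>+s\<in>{1/t..}. ennreal (f s / s) \<partial>lborel)
      = (\<integral>\<^sup>+s\<in>{0<..}. (ennreal (f s / s) * indicator {1/t..} s) \<partial>lborel)"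
  proof (intro nn_integral_cong)
    fix s :: real
    have "0 < s" if "1 / t \<le> s"
      using that assms(2) by (auto intro: less_le_trans[of 0 "1 / t"])
    then show "ennreal (f s / s) * indicator {1/t..} s
        = ennreal (f s / s) * indicator {1/t..} s * indicator {0<..} s"
      by (simp split: split_indicator)
  qed
  also have "\<dots> = (\<integral>\<^sup>+s\<in>{0<..}. (ennreal (f (1 / s) / (1 / s)) * indicator {1/t..} (1 / s)) * ennreal (1 / s\<^sup>2) \<partial>lborel)"
    by (rule nn_integral_inverse[where F = "\<lambda>s. ennreal (f s / s) * indicator {1/t..} s"]) measurable
  also have "\<dots> = (\<integral>\<^sup>+s\<in>{0..t}. ennreal (inversion f s) \<partial>lborel)"
  proof (rule nn_integral_lborel_cong_finite[of "{0}"])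
    fix s :: real assume "s \<notin> {0}"
    then have "s \<noteq> 0" by simp
    have "ennreal (f (1 / s) / (1 / s)) * ennreal (1 / s\<^sup>2) = ennreal (inversion f s)" if "0 < s"
      using that by (subst ennreal_mult''[symmetric]) (simp_all add: inversion_def power2_eq_square)
    moreover have "1 / t \<le> 1 / s \<longleftrightarrow> s \<le> t" if "0 < s"
      using that assms(2) by (simp add: field_simps)
    ultimately show "ennreal (f (1 / s) / (1 / s)) * indicator {1/t..} (1 / s) * ennreal (1 / s\<^sup>2) * indicator {0<..} s
        = ennreal (inversion f s) * indicator {0..t} s"
      using assms(2) \<open>s \<noteq> 0\<close> by (auto split: split_indicator)
  qed simp
  finally show ?thesis
    using assms(2) by (simp add: hardy_avg_lborel hardy_dual_lborel mult.assoc[symmetric] flip: ennreal_mult)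
qed

text \<open>The exponent \<open>p - 2 - a\<close> collects \<open>t powr p\<close> from the factor
  \<open>t\<close> in \<open>inv\<close>, \<open>t powr (- a)\<close> from the weight and
  \<open>t powr (- 2)\<close> from the Jacobian.\<close>

lemma weighted_power_integral_inverse:
  assumes [measurable]: "g \<in> borel_measurable borel" "h \<in> borel_measurable borel"
    and inv: "\<And>t. 0 < t \<Longrightarrow> g (1 / t) = ennreal t * h t"
  shows "weighted_power_integral p a g = weighted_power_integral p (p - 2 - a) h"
proof -
  have "weighted_power_integral p a g = (\<integral>\<^sup>+t\<in>{0<..}.
      (ennreal_rpow (g (1 / t)) p * ennreal ((1 / t) powr a)) * ennreal (1 / t\<^sup>2) \<partial>lborel)"
    unfolding weighted_power_integral_lborel
    by (rule nn_integral_inverse[where F = "\<lambda>t. ennreal_rpow (g t) p * ennreal (t powr a)"]) measurable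
  also have "\<dots> = (\<integral>\<^sup>+t\<in>{0<..}. ennreal_rpow (h t) p * ennreal (t powr (p - 2 - a)) \<partial>lborel)"
  proof (intro nn_integral_cong)
    fix t :: real
    have "ennreal_rpow (g (1 / t)) p * ennreal ((1 / t) powr a) * ennreal (1 / t\<^sup>2)
        = ennreal_rpow (h t) p * ennreal (t powr (p - 2 - a))" if "0 < t"
    proof -
      have "t powr (p - 2 - a) = t powr (p + (- a + (- 2)))"
        by (rule arg_cong[where f = "(powr) t"]) simp
      also have "\<dots> = t powr p * ((1 / t) powr a * (1 / t\<^sup>2))"
        using that by (simp only: powr_add powr_minus) (simp add: powr_divide inverse_eq_divide)
      finally have eq: "t powr (p - 2 - a) = t powr p * ((1 / t) powr a * (1 / t\<^sup>2))" .
      have "ennreal_rpow (g (1 / t)) p * ennreal ((1 / t) powr a) * ennreal (1 / t\<^sup>2)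
          = ennreal_rpow (h t) p * (ennreal (t powr p) * (ennreal ((1 / t) powr a) * ennreal (1 / t\<^sup>2)))"
        unfolding inv[OF that] ennreal_rpow_cmult[OF that] by (simp only: mult_ac)
      also have "ennreal (t powr p) * (ennreal ((1 / t) powr a) * ennreal (1 / t\<^sup>2)) = ennreal (t powr (p - 2 - a))"
        unfolding eq by (subst ennreal_mult, simp, simp, subst ennreal_mult, simp, simp, rule refl)
      finally show ?thesis .
    qed
    then show "ennreal_rpow (g (1 / t)) p * ennreal ((1 / t) powr a) * ennreal (1 / t\<^sup>2) * indicator {0<..} t
        = ennreal_rpow (h t) p * ennreal (t powr (p - 2 - a)) * indicator {0<..} t"
      by (auto split: split_indicator)
  qed
  finally show ?thesis
    by (simp add: weighted_power_integral_lborel)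
qed

lemma weighted_power_integral_hardy_avg_inversion:
  assumes [measurable]: "f \<in> borel_measurable borel"
  shows "weighted_power_integral p a (hardy_avg f) =
    weighted_power_integral p (p - 2 - a) (hardy_dual (inversion f))"
  by (rule weighted_power_integral_inverse) (simp_all add: hardy_avg_inverse)

lemma weighted_power_integral_hardy_dual_inversion:
  assumes [measurable]: "f \<in> borel_measurable borel"
  shows "weighted_power_integral p a (hardy_dual f) =
    weighted_power_integral p (p - 2 - a) (hardy_avg (inversion f))"
  by (rule weighted_power_integral_inverse) (simp_all add: hardy_dual_inverse)

section \<open>The average of the dual transform\<close>

lemma hardy_dual_antimono: "0 < s \<Longrightarrow> s \<le> t \<Longrightarrow> hardy_dual f t \<le> hardy_dual f s"
  unfolding hardy_dual_def by (intro nn_integral_mono) (auto split: split_indicator)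

text \<open>After exchanging the integrals, the section at \<open>u > 0\<close> is
  \<open>(0, min t u]\<close>. Its length times \<open>f u / u\<close> is \<open>f u\<close> for
  \<open>u < t\<close>, the integrand of the average, and \<open>t * f u / u\<close> for
  \<open>u > t\<close>, the integrand of the dual. Finiteness ensures that \<open>enn2real\<close>
  loses nothing.\<close>

lemma hardy_avg_hardy_dual:
  assumes [measurable]: "f \<in> borel_measurable borel" and nonneg: "\<And>s. 0 \<le> f s" and t: "0 < t"
    and fin: "\<And>s. 0 < s \<Longrightarrow> hardy_dual f s < \<infinity>"
  shows "hardy_avg (\<lambda>s. enn2real (hardy_dual f s)) t = hardy_avg f t + hardy_dual f t"
proof -
  let ?k = "\<lambda>s u::real. if 0 < s \<and> s \<le> t \<and> s \<le> u then 1 else 0 :: ennreal"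
  have "(\<integral>\<^sup>+s\<in>{0..t}. ennreal (enn2real (hardy_dual f s)) \<partial>lborel)
      = (\<integral>\<^sup>+s. (\<integral>\<^sup>+u. ennreal (f u / u) * ?k s u \<partial>lborel) \<partial>lborel)"
  proof (rule nn_integral_lborel_cong_finite[of "{0}"])
    fix s :: real assume "s \<notin> {0}"
    then have "s \<noteq> 0" by simp
    then show "ennreal (enn2real (hardy_dual f s)) * indicator {0..t} s =
        (\<integral>\<^sup>+u. ennreal (f u / u) * ?k s u \<partial>lborel)"
    proof (cases "0 < s \<and> s \<le> t")
      case True
      then have "ennreal (enn2real (hardy_dual f s)) * indicator {0..t} s = hardy_dual f s"
        using fin[of s] by simp
      also have "\<dots> = (\<integral>\<^sup>+u. ennreal (f u / u) * ?k s u \<partial>lborel)"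
        unfolding hardy_dual_lborel using True by (intro nn_integral_cong) (simp split: split_indicator)
      finally show ?thesis .
    next
      case False
      then have k: "?k s u = 0" for u by auto
      show ?thesis using False \<open>s \<noteq> 0\<close> by (simp only: k) (simp add: indicator_def)
    qed
  qed simp
  also have "\<dots> = (\<integral>\<^sup>+u. (\<integral>\<^sup>+s. ennreal (f u / u) * ?k s u \<partial>lborel) \<partial>lborel)"
    by (rule lborel_pair.Fubini') measurable
  also have "\<dots> = (\<integral>\<^sup>+u. ennreal (f u) * indicator {0..t} u
      + ennreal t * (ennreal (f u / u) * indicator {t..} u) \<partial>lborel)"
  \<comment> \<open>At \<open>u = t\<close> both indicators on the right are \<open>1\<close>, and
    at \<open>u = 0\<close> the quotient \<open>f u / u\<close> has the default value
    \<open>0\<close>; these two points are discarded.\<close>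
  proof (rule nn_integral_lborel_cong_finite[of "{0, t}"])
    fix u :: real assume "u \<notin> {0, t}"
    then have u: "u \<noteq> 0" "u \<noteq> t" by auto
    have "(\<integral>\<^sup>+s. ennreal (f u / u) * ?k s u \<partial>lborel)
        = ennreal (f u / u) * (\<integral>\<^sup>+s. indicator {0<..min t u} s \<partial>lborel)"
      by (subst nn_integral_cmult[symmetric]) (auto intro!: nn_integral_cong simp: indicator_def)
    also have "(\<integral>\<^sup>+s. indicator {0<..min t u} s \<partial>lborel) = ennreal (max 0 (min t u))"
      using t by (cases "0 < u") (auto simp: max_def)
    finally show "(\<integral>\<^sup>+s. ennreal (f u / u) * ?k s u \<partial>lborel) = ennreal (f u) * indicator {0..t} u
      + ennreal t * (ennreal (f u / u) * indicator {t..} u)"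
      using u t nonneg[of u]
      by (cases "u < 0"; cases "u < t")
         (simp_all add: max_def min_def mult.commute ennreal_neg flip: ennreal_mult)
  qed simp
  also have "\<dots> = (\<integral>\<^sup>+s\<in>{0..t}. ennreal (f s) \<partial>lborel) + ennreal t * hardy_dual f t"
    by (simp add: nn_integral_add nn_integral_cmult hardy_dual_lborel)
  finally show ?thesis
    using t by (simp add: hardy_avg_lborel distrib_left mult.assoc[symmetric] ennreal_mult[symmetric])
qed

subsection \<open>Decreasing functions\<close>

lemma hardy_avg_cong:
  assumes "\<And>s. 0 < s \<Longrightarrow> f s = g s"
  shows "hardy_avg f t = hardy_avg g t"
  unfolding hardy_avg_lborel
proof (rule arg_cong2[where f = "(*)", OF refl], rule nn_integral_lborel_cong_finite[of "{0}"])
  fix s :: real assume "s \<notin> {0}"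
  then show "ennreal (f s) * indicator {0..t} s = ennreal (g s) * indicator {0..t} s"
    using assms[of s] by (cases "0 < s") auto
qed simp

lemma borel_measurable_antimono_on_positive:
  fixes \<phi> :: "real \<Rightarrow> real"
  assumes "antimono_on {0<..} \<phi>"
  shows "(\<lambda>t. if 0 < t then \<phi> t else 0) \<in> borel_measurable borel"
proof -
  have "mono_on {0<..} (\<lambda>t. - \<phi> t)"
    using assms by (auto simp: monotone_on_def)
  then have "(\<lambda>t. - \<phi> t) \<in> borel_measurable (restrict_space borel {0<..})"
    by (rule borel_measurable_mono_on_fnc)
  then have "(\<lambda>t. - (- \<phi> t)) \<in> borel_measurable (restrict_space borel {0<..})"
    by (rule borel_measurable_uminus)
  then have "(\<lambda>t. indicator {0<..} t *\<^sub>R \<phi> t) \<in> borel_measurable borel"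
    by (subst (asm) borel_measurable_restrict_space_iff) simp_all
  moreover have "(\<lambda>t. indicator {0<..} t *\<^sub>R \<phi> t) = (\<lambda>t. if 0 < t then \<phi> t else 0)"
    by (auto simp: indicator_def)
  ultimately show ?thesis by simp
qed

section \<open>Pointwise decay of decreasing functions\<close>

lemma powr_bound_solve:
  fixes x u p b i :: real
  assumes "0 \<le> x" "0 < u" "0 < p" "0 < b" "x powr p * u powr b / b \<le> i"
  shows "x \<le> (b * i) powr (1 / p) * u powr (- (b / p))"
proof -
  have "0 \<le> i"
    using assms by (smt (verit) divide_nonneg_pos mult_nonneg_nonneg powr_ge_zero)
  have "x powr p \<le> b * i * u powr (- b)"
    using assms by (simp add: powr_minus field_simps)
  then have "(x powr p) powr (1 / p) \<le> (b * i * u powr (- b)) powr (1 / p)"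
    using assms by (intro powr_mono2) auto
  then show ?thesis
    using assms \<open>0 \<le> i\<close> by (simp add: powr_powr powr_mult)
qed

text \<open>On \<open>(0, u]\<close> a decreasing \<open>\<phi>\<close> is at least
  \<open>\<phi> u\<close>, and \<open>v powr (b - 1)\<close> has integral
  \<open>u powr b / b\<close> there. With \<open>b = a + 1\<close> this turns a finite weighted
  integral into decay; with a larger \<open>b\<close> it does the work of Hoelder's inequality in
  \<open>hardy_inequality_decreasing\<close>.\<close>

lemma decreasing_powr_le_integral:
  assumes nonneg: "\<And>s. 0 \<le> \<phi> s" and dec: "antimono_on {0<..} \<phi>"
    and "0 \<le> p" "0 < b" "0 < u" "u \<le> t"
  shows "ennreal (\<phi> u powr p * u powr b / b)
    \<le> (\<integral>\<^sup>+v\<in>{0..t}. ennreal (\<phi> v powr p * v powr (b - 1)) \<partial>lborel)"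
proof -
  have "ennreal (\<phi> u powr p * u powr b / b)
      = ennreal (\<phi> u powr p) * (\<integral>\<^sup>+v\<in>{0..u}. ennreal (v powr (b - 1)) \<partial>lborel)"
    using assms by (subst nn_integral_powr_from_0) (simp_all flip: ennreal_mult)
  also have "\<dots> = (\<integral>\<^sup>+v. ennreal (\<phi> u powr p) * (ennreal (v powr (b - 1)) * indicator {0..u} v) \<partial>lborel)"
    by (rule nn_integral_cmult[symmetric]) measurable
  also have "\<dots> \<le> (\<integral>\<^sup>+v\<in>{0..t}. ennreal (\<phi> v powr p * v powr (b - 1)) \<partial>lborel)"
  proof (rule nn_integral_mono)
    fix v
    have "\<phi> u powr p * v powr (b - 1) \<le> \<phi> v powr p * v powr (b - 1)" if "0 < v" "v \<le> u"
      using monotone_onD[OF dec, of v u] that assms nonneg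
      by (intro mult_right_mono powr_mono2) auto
    then show "ennreal (\<phi> u powr p) * (ennreal (v powr (b - 1)) * indicator {0..u} v)
        \<le> ennreal (\<phi> v powr p * v powr (b - 1)) * indicator {0..t} v"
      using assms
      by (cases "v = 0") (auto split: split_indicator simp: ennreal_mult[symmetric] intro!: ennreal_leI)
  qed
  finally show ?thesis .
qed

lemma hardy_avg_le_powr:
  assumes "0 < t" "0 \<le> M" "q < 1" and le: "\<And>u. 0 < u \<Longrightarrow> u \<le> t \<Longrightarrow> \<phi> u \<le> M * u powr (- q)"
  shows "hardy_avg \<phi> t \<le> ennreal (M * t powr (- q) / (1 - q))"
proof -
  have "(\<integral>\<^sup>+s\<in>{0..t}. ennreal (\<phi> s) \<partial>lborel) = (\<integral>\<^sup>+s\<in>{0<..t}. ennreal (\<phi> s) \<partial>lborel)"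
    by (rule nn_integral_lborel_cong_finite[of "{0}"]) (auto split: split_indicator)
  also have "\<dots> \<le> (\<integral>\<^sup>+s. ennreal M * (ennreal (s powr (- q)) * indicator {0..t} s) \<partial>lborel)"
    using le assms
    by (intro nn_integral_mono) (auto split: split_indicator simp: ennreal_mult[symmetric] intro!: ennreal_leI)
  also have "\<dots> = ennreal (M * (t powr (1 - q) / (1 - q)))"
    using assms
    by (subst nn_integral_cmult, measurable, subst nn_integral_powr_from_0) (simp_all flip: ennreal_mult)
  finally have "hardy_avg \<phi> t \<le> ennreal (1 / t) * ennreal (M * (t powr (1 - q) / (1 - q)))"
    unfolding hardy_avg_lborel by (rule mult_left_mono) simp
  also have "\<dots> = ennreal ((1 / t) * (M * (t powr (1 - q) / (1 - q))))"
    using assms by (intro ennreal_mult[symmetric]) auto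
  also have "(1 / t) * (M * (t powr (1 - q) / (1 - q))) = M * t powr (- q) / (1 - q)"
    using assms by (simp add: powr_diff powr_minus field_simps)
  finally show ?thesis .
qed

text \<open>The exponent \<open>(a + 1) / p\<close> is positive, so the bound is integrable against
  \<open>ds / s\<close> at infinity; if also \<open>a < p - 1\<close> it is below \<open>1\<close>,
  so the bound is integrable at \<open>0\<close>. The next two lemmas draw these conclusions for
  \<open>hardy_dual\<close> and \<open>hardy_avg\<close>.\<close>

lemma decreasing_powr_bound:
  assumes [measurable]: "\<phi> \<in> borel_measurable borel"
    and nonneg: "\<And>s. 0 \<le> \<phi> s" and dec: "antimono_on {0<..} \<phi>"
    and "0 < p" "-1 < a" and fin: "weighted_power_integral p a (\<lambda>t. ennreal (\<phi> t)) < \<infinity>"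
  obtains M where "0 \<le> M" "\<And>u. 0 < u \<Longrightarrow> \<phi> u \<le> M * u powr (- ((a + 1) / p))"
proof -
  obtain w where w: "weighted_power_integral p a (\<lambda>t. ennreal (\<phi> t)) = ennreal w" "0 \<le> w"
    using fin by (cases "weighted_power_integral p a (\<lambda>t. ennreal (\<phi> t))") auto
  show thesis
  proof (rule that)
    show "0 \<le> ((a + 1) * w) powr (1 / p)" by simp
    fix u :: real assume u: "0 < u"
    have "ennreal (\<phi> u powr p * u powr (a + 1) / (a + 1))
        \<le> (\<integral>\<^sup>+v\<in>{0..u}. ennreal (\<phi> v powr p * v powr (a + 1 - 1)) \<partial>lborel)"
      using assms u by (intro decreasing_powr_le_integral) auto
    also have "\<dots> \<le> weighted_power_integral p a (\<lambda>t. ennreal (\<phi> t))"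
      unfolding weighted_power_integral_lborel
    proof (rule nn_integral_mono)
      fix v :: real
      show "ennreal (\<phi> v powr p * v powr (a + 1 - 1)) * indicator {0..u} v
          \<le> ennreal_rpow (ennreal (\<phi> v)) p * ennreal (v powr a) * indicator {0<..} v"
        by (cases "v = 0") (auto split: split_indicator simp: ennreal_rpow_ennreal nonneg ennreal_mult)
    qed
    finally have "\<phi> u powr p * u powr (a + 1) / (a + 1) \<le> w"
      using w by simp
    then show "\<phi> u \<le> ((a + 1) * w) powr (1 / p) * u powr (- ((a + 1) / p))"
      using assms u by (intro powr_bound_solve) auto
  qed
qed

lemma hardy_avg_decreasing_finite:
  assumes "\<phi> \<in> borel_measurable borel" "\<And>s. 0 \<le> \<phi> s" "antimono_on {0<..} \<phi>"
    and "0 < p" "-1 < a" "a < p - 1" "weighted_power_integral p a (\<lambda>t. ennreal (\<phi> t)) < \<infinity>"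
    and "0 < t"
  shows "hardy_avg \<phi> t < \<infinity>"
proof -
  obtain M where M: "0 \<le> M" "\<And>u. 0 < u \<Longrightarrow> \<phi> u \<le> M * u powr (- ((a + 1) / p))"
    using decreasing_powr_bound[OF assms(1-5,7)] by blast
  have "hardy_avg \<phi> t \<le> ennreal (M * t powr (- ((a + 1) / p)) / (1 - (a + 1) / p))"
    using assms M by (intro hardy_avg_le_powr) auto
  also have "\<dots> < \<infinity>" by simp
  finally show ?thesis .
qed

text \<open>Needed for the sharpness argument, where a value of \<open>hardy_dual \<phi>\<close> is
  cancelled from both sides of an inequality in \<open>[0, \<infinity>]\<close>.\<close>

lemma hardy_dual_decreasing_finite:
  assumes "\<phi> \<in> borel_measurable borel" "\<And>s. 0 \<le> \<phi> s" "antimono_on {0<..} \<phi>"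
    and "0 < p" "-1 < a" "weighted_power_integral p a (\<lambda>t. ennreal (\<phi> t)) < \<infinity>"
    and "0 < t"
  shows "hardy_dual \<phi> t < \<infinity>"
proof -
  obtain M where M: "0 \<le> M" "\<And>u. 0 < u \<Longrightarrow> \<phi> u \<le> M * u powr (- ((a + 1) / p))"
    using decreasing_powr_bound[OF assms(1-6)] by blast
  let ?e = "- ((a + 1) / p) - 1"
  have "hardy_dual \<phi> t \<le> (\<integral>\<^sup>+s. ennreal M * (ennreal (s powr ?e) * indicator {t..} s) \<partial>lborel)"
    unfolding hardy_dual_lborel
  proof (rule nn_integral_mono)
    fix s
    have "\<phi> s / s \<le> M * s powr ?e" if "t \<le> s"
      using M(2)[of s] that assms(7) by (simp add: powr_diff divide_right_mono)
    then show "ennreal (\<phi> s / s) * indicator {t..} s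
        \<le> ennreal M * (ennreal (s powr ?e) * indicator {t..} s)"
      using M(1) by (auto split: split_indicator simp: ennreal_mult[symmetric] intro!: ennreal_leI)
  qed
  also have "\<dots> = ennreal M * (\<integral>\<^sup>+s\<in>{t..}. ennreal (s powr ?e) \<partial>lborel)"
    by (rule nn_integral_cmult) measurable
  also have "\<dots> = ennreal M * ennreal (t powr (?e + 1) / (- ?e - 1))"
    using assms by (subst nn_integral_powr_to_inf) auto
  also have "\<dots> < \<infinity>" by (simp add: ennreal_mult_less_top)
  finally show ?thesis .
qed

lemma le_hardy_avg_decreasing:
  assumes nonneg: "\<And>s. 0 \<le> \<phi> s" and dec: "antimono_on {0<..} \<phi>" and t: "0 < t"
  shows "ennreal (\<phi> t) \<le> hardy_avg \<phi> t"
proof -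
  have "ennreal (\<phi> t) = ennreal (1 / t) * (\<integral>\<^sup>+s\<in>{0..t}. ennreal (\<phi> t) \<partial>lborel)"
    using t nonneg[of t] by (subst nn_integral_const_Icc) (simp_all flip: ennreal_mult)
  also have "(\<integral>\<^sup>+s\<in>{0..t}. ennreal (\<phi> t) \<partial>lborel) = (\<integral>\<^sup>+s\<in>{0<..t}. ennreal (\<phi> t) \<partial>lborel)"
    by (rule nn_integral_lborel_cong_finite[of "{0}"]) (auto split: split_indicator)
  also have "\<dots> \<le> (\<integral>\<^sup>+s\<in>{0..t}. ennreal (\<phi> s) \<partial>lborel)"
    using monotone_onD[OF dec] t
    by (intro nn_integral_mono) (auto split: split_indicator intro!: ennreal_leI)
  finally show ?thesis
    unfolding hardy_avg_lborel by (simp add: mult_left_mono)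
qed

text \<open>A crude form of Hardy's inequality, which shows that the set of admissible constants in the
  definition of \<open>hardy_const\<close> is not empty.\<close>

lemma hardy_inequality_decreasing:
  assumes p: "0 < p" and a: "-1 < a" "a < p - 1"
  obtains K where "0 \<le> K"
    "\<And>\<phi>. \<phi> \<in> borel_measurable borel \<Longrightarrow> (\<And>s. 0 \<le> \<phi> s) \<Longrightarrow> antimono_on {0<..} \<phi> \<Longrightarrow>
       weighted_power_integral p a (hardy_avg \<phi>)
         \<le> ennreal K * weighted_power_integral p a (\<lambda>t. ennreal (\<phi> t))"
proof -
  \<comment> \<open>The midpoint of \<open>a + 1\<close> and \<open>p\<close>. Being below
    \<open>p\<close>, it makes \<open>u powr (- (b / p))\<close> integrable at \<open>0\<close>;
    being above \<open>a + 1\<close>, it makes \<open>t powr (a - b)\<close> integrable at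
    infinity.\<close>
  define b where "b = (a + 1 + p) / 2"
  have b: "a + 1 < b" "b < p" "0 < b" using a unfolding b_def by (simp_all add: field_simps)
  define c where "c = b * (1 - b / p) powr (- p)"
  have bp: "b / p < 1" using b p by simp
  have c: "0 < c" using b bp unfolding c_def by simp
  show thesis
  proof (rule that)
    show "0 \<le> c * (1 / (b - a - 1))" using c b by simp
    fix \<phi> :: "real \<Rightarrow> real"
    assume [measurable]: "\<phi> \<in> borel_measurable borel" and nonneg: "\<And>s. 0 \<le> \<phi> s"
      and dec: "antimono_on {0<..} \<phi>"
    define I where "I t = (\<integral>\<^sup>+v\<in>{0..t}. ennreal (\<phi> v powr p * v powr (b - 1)) \<partial>lborel)" for t
    \<comment> \<open>Monotonicity bounds \<open>\<phi>\<close> on \<open>(0, t]\<close> by a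
      multiple of \<open>u powr (- (b / p))\<close> whose coefficient depends only on
      \<open>I t\<close>. Averaging this bound and raising it to the power \<open>p\<close> produces
      the constant \<open>c\<close>.\<close>
    have pointwise: "ennreal_rpow (hardy_avg \<phi> t) p \<le> ennreal (c * t powr (- b)) * I t" if t: "0 < t" for t
    proof (cases "I t")
      case (real i)
      have "\<phi> u \<le> (b * i) powr (1 / p) * u powr (- (b / p))" if "0 < u" "u \<le> t" for u
      proof -
        have "ennreal (\<phi> u powr p * u powr b / b) \<le> I t"
          unfolding I_def using nonneg dec p b that by (intro decreasing_powr_le_integral) auto
        then have "\<phi> u powr p * u powr b / b \<le> i"
          using real by simp
        then show ?thesis
          using nonneg p b that by (intro powr_bound_solve) auto
      qed
      then have "hardy_avg \<phi> t \<le> ennreal ((b * i) powr (1 / p) * t powr (- (b / p)) / (1 - b / p))"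
        using t bp by (intro hardy_avg_le_powr) auto
      then have "ennreal_rpow (hardy_avg \<phi> t) p
          \<le> ennreal_rpow (ennreal ((b * i) powr (1 / p) * t powr (- (b / p)) / (1 - b / p))) p"
        using p by (intro ennreal_rpow_mono) auto
      also have "\<dots> = ennreal (((b * i) powr (1 / p) * t powr (- (b / p)) / (1 - b / p)) powr p)"
        using bp by (intro ennreal_rpow_ennreal) auto
      also have "((b * i) powr (1 / p) * t powr (- (b / p)) / (1 - b / p)) powr p = c * t powr (- b) * i"
      proof -
        have "((b * i) powr (1 / p) * t powr (- (b / p)) / (1 - b / p)) powr p
            = ((b * i) powr (1 / p)) powr p * (t powr (- (b / p))) powr p / (1 - b / p) powr p"
          using bp by (simp add: powr_divide powr_mult)
        also have "\<dots> = ((b * i) powr (1 / p)) powr p * (t powr (- (b / p))) powr p * (1 - b / p) powr (- p)"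
          by (simp only: powr_minus divide_inverse)
        also have "\<dots> = b * i * t powr (- b) * (1 - b / p) powr (- p)"
          using p b real by (simp add: powr_powr)
        finally show ?thesis unfolding c_def by (simp only: mult_ac)
      qed
      also have "ennreal \<dots> = ennreal (c * t powr (- b)) * I t"
        using real c by (simp add: ennreal_mult)
      finally show ?thesis .
    next
      case top
      then show ?thesis using c t by (simp add: ennreal_mult_top)
    qed
    let ?k = "\<lambda>t v::real. if 0 < v \<and> v \<le> t then 1 else 0 :: ennreal"
    have "weighted_power_integral p a (hardy_avg \<phi>)
        \<le> (\<integral>\<^sup>+t\<in>{0<..}. (ennreal (c * t powr (- b)) * I t) * ennreal (t powr a) \<partial>lborel)"
      unfolding weighted_power_integral_lborel using pointwise
      by (intro nn_integral_mono) (auto split: split_indicator intro!: mult_right_mono)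
    also have "\<dots> = (\<integral>\<^sup>+t. (\<integral>\<^sup>+v. ennreal c * (ennreal (\<phi> v powr p * v powr (b - 1)) *
        (ennreal (t powr (a - b)) * ?k t v)) \<partial>lborel) \<partial>lborel)"
    proof (rule nn_integral_cong)
      fix t :: real
      show "ennreal (c * t powr (- b)) * I t * ennreal (t powr a) * indicator {0<..} t
          = (\<integral>\<^sup>+v. ennreal c * (ennreal (\<phi> v powr p * v powr (b - 1)) *
        (ennreal (t powr (a - b)) * ?k t v)) \<partial>lborel)"
      proof (cases "0 < t")
        case True
        have I: "I t = (\<integral>\<^sup>+v. ennreal (\<phi> v powr p * v powr (b - 1)) * ?k t v \<partial>lborel)"
          unfolding I_def
          by (rule nn_integral_lborel_cong_finite[of "{0}"]) (auto split: split_indicator)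
        have "c * t powr (a - b) = c * t powr (- b) * t powr a"
          by (simp flip: powr_add)
        then have "ennreal (c * t powr (- b)) * I t * ennreal (t powr a) = ennreal (c * t powr (a - b)) * I t"
          using c by (simp add: ennreal_mult mult_ac)
        also have "\<dots> = (\<integral>\<^sup>+v. ennreal (c * t powr (a - b)) * (ennreal (\<phi> v powr p * v powr (b - 1)) * ?k t v) \<partial>lborel)"
          unfolding I by (rule nn_integral_cmult[symmetric]) measurable
        also have "\<dots> = (\<integral>\<^sup>+v. ennreal c * (ennreal (\<phi> v powr p * v powr (b - 1)) *
            (ennreal (t powr (a - b)) * ?k t v)) \<partial>lborel)"
          using c by (intro nn_integral_cong) (simp add: ennreal_mult mult_ac)
        finally show ?thesis using True by simp
      next
        case False
        then have k: "?k t v = 0" for v by auto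
        show ?thesis using False by (simp only: k) simp
      qed
    qed
    \<comment> \<open>With the order exchanged, integrating \<open>t powr (a - b)\<close> over
      \<open>t \<ge> v\<close> gives \<open>v powr (a - b + 1) / (b - a - 1)\<close>, which turns
      the auxiliary weight \<open>v powr (b - 1)\<close> back into \<open>v powr a\<close>.\<close>
    also have "\<dots> = (\<integral>\<^sup>+v. (\<integral>\<^sup>+t. ennreal c * (ennreal (\<phi> v powr p * v powr (b - 1)) *
        (ennreal (t powr (a - b)) * ?k t v)) \<partial>lborel) \<partial>lborel)"
      by (rule lborel_pair.Fubini') measurable
    also have "\<dots> = (\<integral>\<^sup>+v. ennreal (c * (1 / (b - a - 1))) *
        (ennreal_rpow (ennreal (\<phi> v)) p * ennreal (v powr a) * indicator {0<..} v) \<partial>lborel)"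
    proof (rule nn_integral_cong)
      fix v :: real
      show "(\<integral>\<^sup>+t. ennreal c * (ennreal (\<phi> v powr p * v powr (b - 1)) *
        (ennreal (t powr (a - b)) * ?k t v)) \<partial>lborel) = ennreal (c * (1 / (b - a - 1))) *
        (ennreal_rpow (ennreal (\<phi> v)) p * ennreal (v powr a) * indicator {0<..} v)"
      proof (cases "0 < v")
        case True
        have "(\<integral>\<^sup>+t. ennreal c * (ennreal (\<phi> v powr p * v powr (b - 1)) *
            (ennreal (t powr (a - b)) * ?k t v)) \<partial>lborel)
            = ennreal c * (ennreal (\<phi> v powr p * v powr (b - 1)) *
            (\<integral>\<^sup>+t. ennreal (t powr (a - b)) * ?k t v \<partial>lborel))"
          by (subst nn_integral_cmult, measurable, subst nn_integral_cmult, measurable)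
        also have "(\<integral>\<^sup>+t. ennreal (t powr (a - b)) * ?k t v \<partial>lborel)
            = (\<integral>\<^sup>+t\<in>{v..}. ennreal (t powr (a - b)) \<partial>lborel)"
          using True by (intro nn_integral_cong) (simp split: split_indicator)
        also have "\<dots> = ennreal (v powr (a - b + 1) / (- (a - b) - 1))"
          using True b by (intro nn_integral_powr_to_inf) auto
        also have "ennreal c * (ennreal (\<phi> v powr p * v powr (b - 1)) * \<dots>)
            = ennreal (c * (\<phi> v powr p * v powr (b - 1) * (v powr (a - b + 1) / (- (a - b) - 1))))"
          by (simp only: ennreal_mult'[symmetric] less_imp_le[OF c] mult_nonneg_nonneg powr_ge_zero)
        also have "c * (\<phi> v powr p * v powr (b - 1) * (v powr (a - b + 1) / (- (a - b) - 1)))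
            = c * (1 / (b - a - 1)) * (\<phi> v powr p * (v powr (b - 1) * v powr (a - b + 1)))"
          by simp
        also have "v powr (b - 1) * v powr (a - b + 1) = v powr a"
          by (simp flip: powr_add)
        also have "ennreal (c * (1 / (b - a - 1)) * (\<phi> v powr p * v powr a))
            = ennreal (c * (1 / (b - a - 1))) * (ennreal (\<phi> v powr p) * ennreal (v powr a))"
          by (simp only: ennreal_mult'' mult_nonneg_nonneg powr_ge_zero)
        finally show ?thesis
          using True nonneg by (simp add: ennreal_rpow_ennreal)
      next
        case False
        then have k: "?k t v = 0" for t by auto
        show ?thesis using False by (simp only: k) simp
      qed
    qed
    also have "\<dots> = ennreal (c * (1 / (b - a - 1))) * weighted_power_integral p a (\<lambda>t. ennreal (\<phi> t))"
      unfolding weighted_power_integral_lborel by (rule nn_integral_cmult) measurable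
    finally show "weighted_power_integral p a (hardy_avg \<phi>)
        \<le> ennreal (c * (1 / (b - a - 1))) * weighted_power_integral p a (\<lambda>t. ennreal (\<phi> t))" .
  qed
qed

subsection \<open>The best constant\<close>

text \<open>Neither side of the inequality depends on \<open>\<phi>\<close> outside the positive
  half-line. Setting \<open>\<phi>\<close> to zero there makes it nonnegative everywhere and, since
  monotone functions are Borel, measurable.\<close>

lemma hardy_diff_boundI:
  assumes "\<And>\<phi>. \<phi> \<in> borel_measurable borel \<Longrightarrow> (\<And>s. 0 \<le> \<phi> s) \<Longrightarrow> antimono_on {0<..} \<phi> \<Longrightarrow>
      weighted_power_integral p a (\<lambda>t. ennreal (\<phi> t)) < \<infinity> \<Longrightarrow>
      weighted_power_integral p a (\<lambda>t. ennreal \<bar>enn2real (hardy_avg \<phi> t) - \<phi> t\<bar>)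
        \<le> ennreal (K powr p) * weighted_power_integral p a (\<lambda>t. ennreal (\<phi> t))"
  shows "hardy_diff_bound p a K"
  unfolding hardy_diff_bound_def
proof (intro allI impI)
  fix \<phi> :: "real \<Rightarrow> real"
  assume nonneg: "\<forall>t>0. 0 \<le> \<phi> t" and dec: "antimono_on {0<..} \<phi>"
    and fin: "weighted_power_integral p a (\<lambda>t. ennreal (\<phi> t)) < \<infinity>"
  define \<psi> where "\<psi> t = (if 0 < t then \<phi> t else 0)" for t
  have eq: "weighted_power_integral p a (\<lambda>t. ennreal (\<psi> t)) = weighted_power_integral p a (\<lambda>t. ennreal (\<phi> t))"
    by (rule weighted_power_integral_cong) (simp add: \<psi>_def)
  have avg: "hardy_avg \<psi> = hardy_avg \<phi>"
    by (rule ext, rule hardy_avg_cong) (simp add: \<psi>_def)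
  have "weighted_power_integral p a (\<lambda>t. ennreal \<bar>enn2real (hardy_avg \<psi> t) - \<psi> t\<bar>)
      \<le> ennreal (K powr p) * weighted_power_integral p a (\<lambda>t. ennreal (\<psi> t))"
  proof (rule assms)
    show "\<psi> \<in> borel_measurable borel"
      unfolding \<psi>_def[abs_def] using dec by (rule borel_measurable_antimono_on_positive)
    show "0 \<le> \<psi> s" for s using nonneg by (simp add: \<psi>_def)
    show "antimono_on {0<..} \<psi>" using dec by (auto simp: monotone_on_def \<psi>_def)
    show "weighted_power_integral p a (\<lambda>t. ennreal (\<psi> t)) < \<infinity>" using fin eq by simp
  qed
  also have "weighted_power_integral p a (\<lambda>t. ennreal \<bar>enn2real (hardy_avg \<psi> t) - \<psi> t\<bar>)
      = weighted_power_integral p a (\<lambda>t. ennreal \<bar>enn2real (hardy_avg \<phi> t) - \<phi> t\<bar>)"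
    by (rule weighted_power_integral_cong) (simp add: \<psi>_def avg)
  finally show "weighted_power_integral p a (\<lambda>t. ennreal \<bar>enn2real (hardy_avg \<phi> t) - \<phi> t\<bar>)
      \<le> ennreal (K powr p) * weighted_power_integral p a (\<lambda>t. ennreal (\<phi> t))"
    unfolding eq .
qed

lemma hardy_diff_boundD:
  assumes "hardy_diff_bound p a K" "\<And>t. 0 < t \<Longrightarrow> 0 \<le> \<phi> t" "antimono_on {0<..} \<phi>"
    and "weighted_power_integral p a (\<lambda>t. ennreal (\<phi> t)) < \<infinity>"
  shows "weighted_power_integral p a (\<lambda>t. ennreal \<bar>enn2real (hardy_avg \<phi> t) - \<phi> t\<bar>)
    \<le> ennreal (K powr p) * weighted_power_integral p a (\<lambda>t. ennreal (\<phi> t))"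
  using assms unfolding hardy_diff_bound_def by blast

lemma ennreal_cmult_le_imp_le:
  assumes "0 < x" "ennreal x * A \<le> B"
  shows "A \<le> ennreal (1 / x) * B"
proof -
  have "A = ennreal (1 / x) * (ennreal x * A)"
    using assms(1) by (simp add: mult.assoc[symmetric] flip: ennreal_mult)
  also have "\<dots> \<le> ennreal (1 / x) * B"
    using assms(2) by (rule mult_left_mono) simp
  finally show ?thesis .
qed

lemma hardy_diff_bound_mono:
  assumes "hardy_diff_bound p a K" "0 \<le> K" "K \<le> L" "0 \<le> p"
  shows "hardy_diff_bound p a L"
proof (rule hardy_diff_boundI)
  fix \<phi> :: "real \<Rightarrow> real"
  assume "\<And>s. 0 \<le> \<phi> s" "antimono_on {0<..} \<phi>"
    "weighted_power_integral p a (\<lambda>t. ennreal (\<phi> t)) < \<infinity>"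
  then have "weighted_power_integral p a (\<lambda>t. ennreal \<bar>enn2real (hardy_avg \<phi> t) - \<phi> t\<bar>)
      \<le> ennreal (K powr p) * weighted_power_integral p a (\<lambda>t. ennreal (\<phi> t))"
    by (intro hardy_diff_boundD[OF assms(1)])
  also have "\<dots> \<le> ennreal (L powr p) * weighted_power_integral p a (\<lambda>t. ennreal (\<phi> t))"
    using assms by (intro mult_right_mono ennreal_leI powr_mono2) auto
  finally show "weighted_power_integral p a (\<lambda>t. ennreal \<bar>enn2real (hardy_avg \<phi> t) - \<phi> t\<bar>)
      \<le> ennreal (L powr p) * weighted_power_integral p a (\<lambda>t. ennreal (\<phi> t))" .
qed

text \<open>For each fixed \<open>\<phi>\<close> with finite weighted integral, the right-hand side
  depends continuously on the constant, also at \<open>0\<close> because \<open>p > 0\<close>. Hence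
  the infimum of the admissible constants is itself admissible.\<close>

lemma hardy_diff_bound_limit:
  assumes p: "0 < p" and k: "0 \<le> k" and bound: "\<And>L. k < L \<Longrightarrow> hardy_diff_bound p a L"
  shows "hardy_diff_bound p a k"
proof (rule hardy_diff_boundI)
  fix \<phi> :: "real \<Rightarrow> real"
  assume nonneg: "\<And>s. 0 \<le> \<phi> s" and dec: "antimono_on {0<..} \<phi>"
    and fin: "weighted_power_integral p a (\<lambda>t. ennreal (\<phi> t)) < \<infinity>"
  let ?L = "weighted_power_integral p a (\<lambda>t. ennreal \<bar>enn2real (hardy_avg \<phi> t) - \<phi> t\<bar>)"
  obtain w where w: "weighted_power_integral p a (\<lambda>t. ennreal (\<phi> t)) = ennreal w" "0 \<le> w"
    using fin by (cases "weighted_power_integral p a (\<lambda>t. ennreal (\<phi> t))") auto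
  have "?L \<le> ennreal ((k + 1 / real (Suc n)) powr p * w)" for n
    using hardy_diff_boundD[OF bound[of "k + 1 / real (Suc n)"] nonneg dec fin] w
    by (simp add: ennreal_mult)
  moreover have "(\<lambda>n. (k + 1 / real (Suc n)) powr p * w) \<longlonglongrightarrow> (k + 0) powr p * w"
    using p k by (intro tendsto_intros tendsto_powr' LIMSEQ_Suc[OF lim_1_over_n]) auto
  then have "(\<lambda>n. ennreal ((k + 1 / real (Suc n)) powr p * w)) \<longlonglongrightarrow> ennreal (k powr p * w)"
    by (intro tendsto_ennrealI) simp
  ultimately have "?L \<le> ennreal (k powr p * w)"
    by (intro LIMSEQ_le_const[where X = "\<lambda>n. ennreal ((k + 1 / real (Suc n)) powr p * w)"]) auto
  then show "?L \<le> ennreal (k powr p) * weighted_power_integral p a (\<lambda>t. ennreal (\<phi> t))"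
    using w by (simp add: ennreal_mult)
qed

text \<open>The average of a decreasing function dominates it, so \<open>H \<phi> - \<phi>\<close>
  lies between \<open>0\<close> and \<open>H \<phi>\<close>, and Hardy's inequality applies.\<close>

lemma hardy_diff_bound_exists:
  assumes p: "0 < p" and a: "-1 < a" "a < p - 1"
  obtains K where "0 \<le> K" "hardy_diff_bound p a K"
proof -
  obtain C where C: "0 \<le> C" and hardy: "\<And>\<phi>. \<phi> \<in> borel_measurable borel \<Longrightarrow> (\<And>s. 0 \<le> \<phi> s) \<Longrightarrow>
      antimono_on {0<..} \<phi> \<Longrightarrow> weighted_power_integral p a (hardy_avg \<phi>)
         \<le> ennreal C * weighted_power_integral p a (\<lambda>t. ennreal (\<phi> t))"
    using hardy_inequality_decreasing[OF assms] by blast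
  have "hardy_diff_bound p a (C powr (1 / p))"
  proof (rule hardy_diff_boundI)
    fix \<phi> :: "real \<Rightarrow> real"
    assume meas: "\<phi> \<in> borel_measurable borel" and nonneg: "\<And>s. 0 \<le> \<phi> s"
      and dec: "antimono_on {0<..} \<phi>"
      and fin: "weighted_power_integral p a (\<lambda>t. ennreal (\<phi> t)) < \<infinity>"
    have "weighted_power_integral p a (\<lambda>t. ennreal \<bar>enn2real (hardy_avg \<phi> t) - \<phi> t\<bar>)
        \<le> weighted_power_integral p a (hardy_avg \<phi>)"
    proof (rule weighted_power_integral_mono)
      fix t :: real assume t: "0 < t"
      obtain h where h: "hardy_avg \<phi> t = ennreal h" "0 \<le> h"
        using hardy_avg_decreasing_finite[OF meas nonneg dec p a fin t]
        by (cases "hardy_avg \<phi> t") auto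
      have "\<phi> t \<le> h"
        using le_hardy_avg_decreasing[OF nonneg dec t] h by simp
      then show "ennreal \<bar>enn2real (hardy_avg \<phi> t) - \<phi> t\<bar> \<le> hardy_avg \<phi> t"
        using h nonneg[of t] by (simp add: ennreal_leI)
    qed (use p in simp)
    also have "\<dots> \<le> ennreal C * weighted_power_integral p a (\<lambda>t. ennreal (\<phi> t))"
      using meas nonneg dec by (rule hardy)
    finally show "weighted_power_integral p a (\<lambda>t. ennreal \<bar>enn2real (hardy_avg \<phi> t) - \<phi> t\<bar>)
        \<le> ennreal ((C powr (1 / p)) powr p) * weighted_power_integral p a (\<lambda>t. ennreal (\<phi> t))"
      using p C by (simp add: powr_powr)
  qed
  then show thesis using that[of "C powr (1 / p)"] by simp
qed

text \<open>The test function is the indicator of \<open>t \<le> 1\<close>: beyond \<open>1\<close>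
  it vanishes while its average is \<open>1 / t\<close>, so the left-hand side is positive. This
  yields \<open>0 < hardy_const p a\<close>.\<close>

lemma not_hardy_diff_bound_0:
  assumes p: "0 < p" and a: "-1 < a" "a < p - 1"
  shows "\<not> hardy_diff_bound p a 0"
proof
  assume bound: "hardy_diff_bound p a 0"
  define \<phi> :: "real \<Rightarrow> real" where "\<phi> t = (if t \<le> 1 then 1 else 0)" for t
  have "weighted_power_integral p a (\<lambda>t. ennreal (\<phi> t)) = (\<integral>\<^sup>+t\<in>{0..1}. ennreal (t powr a) \<partial>lborel)"
    unfolding weighted_power_integral_lborel
    by (rule nn_integral_lborel_cong_finite[of "{0}"])
       (auto simp: \<phi>_def ennreal_rpow_def split: split_indicator)
  also have "\<dots> < \<infinity>"
    using a by (subst nn_integral_powr_from_0) auto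
  finally have fin: "weighted_power_integral p a (\<lambda>t. ennreal (\<phi> t)) < \<infinity>" .
  have avg: "hardy_avg \<phi> t = ennreal (1 / t)" if "2 \<le> t" for t
  proof -
    have "(\<integral>\<^sup>+s\<in>{0..t}. ennreal (\<phi> s) \<partial>lborel) = (\<integral>\<^sup>+s\<in>{0..1::real}. ennreal 1 \<partial>lborel)"
      using that by (intro nn_integral_cong) (auto simp: \<phi>_def split: split_indicator)
    then show ?thesis by (simp add: hardy_avg_lborel)
  qed
  have "(\<integral>\<^sup>+t\<in>{2..}. ennreal (t powr (a - p)) \<partial>lborel)
      \<le> weighted_power_integral p a (\<lambda>t. ennreal \<bar>enn2real (hardy_avg \<phi> t) - \<phi> t\<bar>)"
    unfolding weighted_power_integral_lborel
  proof (rule nn_integral_mono)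
    fix t :: real
    show "ennreal (t powr (a - p)) * indicator {2..} t
        \<le> ennreal_rpow (ennreal \<bar>enn2real (hardy_avg \<phi> t) - \<phi> t\<bar>) p * ennreal (t powr a) * indicator {0<..} t"
    proof (cases "2 \<le> t")
      case True
      then have "\<bar>enn2real (hardy_avg \<phi> t) - \<phi> t\<bar> = 1 / t"
        by (simp add: avg \<phi>_def)
      moreover have "(1 / t) powr p * t powr a = t powr (a - p)"
        using True by (simp add: powr_divide powr_diff)
      ultimately show ?thesis
        using True by (simp add: ennreal_rpow_ennreal flip: ennreal_mult)
    qed simp
  qed
  also have "\<dots> \<le> ennreal (0 powr p) * weighted_power_integral p a (\<lambda>t. ennreal (\<phi> t))"
    using fin by (intro hardy_diff_boundD[OF bound]) (auto simp: \<phi>_def monotone_on_def)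
  finally show False
    using a by (subst (asm) nn_integral_powr_to_inf) auto
qed

lemma hardy_const_properties:
  assumes p: "0 < p" and a: "-1 < a" "a < p - 1"
  shows hardy_const_pos: "0 < hardy_const p a"
    and hardy_diff_bound_hardy_const: "hardy_diff_bound p a (hardy_const p a)"
    and hardy_const_le: "\<And>K. 0 \<le> K \<Longrightarrow> hardy_diff_bound p a K \<Longrightarrow> hardy_const p a \<le> K"
proof -
  \<comment> \<open>Every number above \<open>Inf S\<close> is admissible by
    \<open>hardy_diff_bound_mono\<close>, so the limit lemma puts \<open>Inf S\<close> into
    \<open>S\<close>, and \<open>LEAST\<close> denotes it.\<close>
  define S where "S = {K. 0 \<le> K \<and> hardy_diff_bound p a K}"
  have ne: "S \<noteq> {}" using hardy_diff_bound_exists[OF assms] unfolding S_def by blast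
  have bdd: "bdd_below S" unfolding S_def by (rule bdd_belowI[of _ 0]) auto
  have nonneg: "0 \<le> Inf S" using ne by (rule cInf_greatest) (simp add: S_def)
  have bound: "hardy_diff_bound p a (Inf S)"
  proof (rule hardy_diff_bound_limit[OF p nonneg])
    fix L assume "Inf S < L"
    then obtain K where "K \<in> S" "K < L" using cInf_lessD[OF ne] by blast
    then show "hardy_diff_bound p a L"
      using p unfolding S_def by (auto intro: hardy_diff_bound_mono[of p a K])
  qed
  have eq: "hardy_const p a = Inf S"
    unfolding hardy_const_def using nonneg bound
    by (intro Least_equality) (auto simp: S_def intro: cInf_lower bdd[unfolded S_def])
  have "Inf S \<noteq> 0" using bound not_hardy_diff_bound_0[OF assms] by metis
  then show "0 < hardy_const p a" using nonneg eq by simp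
  show "hardy_diff_bound p a (hardy_const p a)" using bound eq by simp
  show "hardy_const p a \<le> K" if "0 \<le> K" "hardy_diff_bound p a K" for K
    using that cInf_lower[OF _ bdd, of K] unfolding eq by (auto simp: S_def)
qed

section \<open>Passage from decreasing functions to arbitrary ones\<close>

lemma hardy_dual_finite:
  assumes fin: "weighted_power_integral p a (hardy_dual f) < \<infinity>" and t: "0 < t"
  shows "hardy_dual f t < \<infinity>"
proof (rule ccontr)
  assume "\<not> hardy_dual f t < \<infinity>"
  \<comment> \<open>An infinite value at \<open>t\<close> spreads by monotonicity to all smaller
    positive arguments, hence to an interval of positive length on which the weight is
    positive.\<close>
  then have top: "hardy_dual f s = \<infinity>" if "0 < s" "s \<le> t" for s
    using hardy_dual_antimono[OF that, of f] by (auto simp: top_unique not_less)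
  have "(\<infinity>::ennreal) = \<infinity> * emeasure lborel {t / 2..t}"
    using t by (simp add: ennreal_top_mult)
  also have "\<dots> = (\<integral>\<^sup>+s\<in>{t/2..t}. \<infinity> \<partial>lborel)"
    by (rule nn_integral_cmult_indicator[symmetric]) simp
  also have "\<dots> \<le> weighted_power_integral p a (hardy_dual f)"
    unfolding weighted_power_integral_lborel
    using t by (intro nn_integral_mono)
      (auto split: split_indicator simp: top ennreal_rpow_def ennreal_top_mult)
  finally show False using fin by simp
qed

lemma hardy_avg_le_hardy_dual:
  assumes p: "0 < p" and a: "-1 < a" "a < p - 1" and f: "nonneg_measurable f"
    and K: "0 < K" and bound: "hardy_diff_bound p a K"
  shows "weighted_power_integral p a (hardy_avg f)
    \<le> ennreal (K powr p) * weighted_power_integral p a (hardy_dual f)"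
proof (cases "weighted_power_integral p a (hardy_dual f) < \<infinity>")
  case False
  \<comment> \<open>The right-hand side is infinite because \<open>K > 0\<close>; a zero factor
    would give \<open>0 * \<infinity> = 0\<close>.\<close>
  then show ?thesis using K by (simp add: ennreal_mult_top not_less top_unique)
next
  case True
  obtain g where g [measurable]: "g \<in> borel_measurable borel" and nonneg: "\<And>s. 0 \<le> g s"
    and avg: "hardy_avg f = hardy_avg g" and "\<And>t. 0 < t \<Longrightarrow> hardy_dual f t = hardy_dual g t"
    using nonneg_measurable_borel_rep[OF f] by blast
  then have dual: "weighted_power_integral p a (hardy_dual f) = weighted_power_integral p a (hardy_dual g)"
    by (intro weighted_power_integral_cong)
  define \<phi> where "\<phi> t = enn2real (hardy_dual g t)" for t
  have fin: "hardy_dual g t < \<infinity>" if "0 < t" for t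
    using True that unfolding dual by (rule hardy_dual_finite)
  then have \<phi>: "ennreal (\<phi> t) = hardy_dual g t" if "0 < t" for t
    using that by (simp add: \<phi>_def)
  have W: "weighted_power_integral p a (\<lambda>t. ennreal (\<phi> t)) = weighted_power_integral p a (hardy_dual g)"
    using \<phi> by (rule weighted_power_integral_cong)
  have dec: "antimono_on {0<..} \<phi>"
    using fin hardy_dual_antimono unfolding \<phi>_def
    by (auto simp: monotone_on_def intro!: enn2real_mono)
  have [measurable]: "\<phi> \<in> borel_measurable borel"
    unfolding \<phi>_def[abs_def] by measurable
  have \<phi>_nonneg: "0 \<le> \<phi> t" for t by (simp add: \<phi>_def)
  have avg_\<phi>: "hardy_avg \<phi> t = hardy_avg g t + ennreal (\<phi> t)" if "0 < t" for t
    using hardy_avg_hardy_dual[OF g nonneg that fin] \<phi>[OF that] by (simp add: \<phi>_def[abs_def])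
  have "hardy_avg g t = ennreal \<bar>enn2real (hardy_avg \<phi> t) - \<phi> t\<bar>" if "0 < t" for t
  proof -
    \<comment> \<open>Finiteness of the sum \<open>avg_\<phi>\<close> is what permits cancelling
      \<open>\<phi> t\<close> through \<open>enn2real\<close>. It follows from the decay of
      \<open>\<phi>\<close>, not from any assumption on \<open>g\<close> near
      \<open>0\<close>.\<close>
    have "hardy_avg \<phi> t < \<infinity>"
      using p a dec that True unfolding dual W[symmetric]
      by (intro hardy_avg_decreasing_finite) (auto simp: \<phi>_nonneg)
    then show ?thesis
      unfolding avg_\<phi>[OF that] using \<phi>_nonneg[of t]
      by (cases "hardy_avg g t") (auto simp flip: ennreal_plus)
  qed
  then have "weighted_power_integral p a (hardy_avg g)
      = weighted_power_integral p a (\<lambda>t. ennreal \<bar>enn2real (hardy_avg \<phi> t) - \<phi> t\<bar>)"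
    by (rule weighted_power_integral_cong)
  also have "\<dots> \<le> ennreal (K powr p) * weighted_power_integral p a (\<lambda>t. ennreal (\<phi> t))"
    using bound dec True \<phi>_nonneg unfolding dual W[symmetric] by (intro hardy_diff_boundD)
  finally show ?thesis
    unfolding avg dual W .
qed

subsection \<open>Sharpness\<close>

lemma dilation_difference_nonneg_measurable:
  fixes \<phi> :: "real \<Rightarrow> real"
  assumes [measurable]: "\<phi> \<in> borel_measurable borel" and dec: "antimono_on {0<..} \<phi>" and l: "1 < l"
  shows "(\<lambda>s. if 0 < s then \<phi> s - \<phi> (l * s) else 0) \<in> borel_measurable borel"
    and "\<And>s. 0 \<le> (if 0 < s then \<phi> s - \<phi> (l * s) else 0)"
proof -
  show "(\<lambda>s. if 0 < s then \<phi> s - \<phi> (l * s) else 0) \<in> borel_measurable borel"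
    by measurable
  show "0 \<le> (if 0 < s then \<phi> s - \<phi> (l * s) else 0)" for s
    using monotone_onD[OF dec, of s "l * s"] l by simp
qed

text \<open>With \<open>A x\<close> the integral of \<open>\<phi>\<close> over
  \<open>{0..x}\<close>, scaling gives \<open>A t - A (l * t) / l\<close> for the integral of the
  difference. By monotonicity \<open>A (l * t)\<close> exceeds \<open>A t\<close> by at most
  \<open>\<phi> t * (l * t - t)\<close>, and dividing by \<open>t\<close> leaves the factor
  \<open>1 - 1 / l\<close>.\<close>

lemma hardy_avg_dilation_difference:
  assumes [measurable]: "\<phi> \<in> borel_measurable borel"
    and nonneg: "\<And>s. 0 \<le> \<phi> s" and dec: "antimono_on {0<..} \<phi>"
    and fin: "hardy_avg \<phi> t < \<infinity>" and l: "1 < l" and t: "0 < t"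
  shows "ennreal (1 - 1 / l) * ennreal \<bar>enn2real (hardy_avg \<phi> t) - \<phi> t\<bar>
    \<le> hardy_avg (\<lambda>s. if 0 < s then \<phi> s - \<phi> (l * s) else 0) t"
proof -
  define f where "f s = (if 0 < s then \<phi> s - \<phi> (l * s) else 0)" for s
  note f = dilation_difference_nonneg_measurable[OF assms(1) dec l, folded f_def[abs_def]]
  note [measurable] = f(1)
  define A where "A x = (\<integral>\<^sup>+s\<in>{0..x}. ennreal (\<phi> s) \<partial>lborel)" for x
  let ?B = "\<integral>\<^sup>+s\<in>{0..t}. ennreal (f s) \<partial>lborel"
  let ?G = "\<integral>\<^sup>+s\<in>{0..t}. ennreal (\<phi> (l * s)) \<partial>lborel"
  have lt: "t \<le> l * t" using l t by simp
  have avg: "hardy_avg \<phi> t = ennreal (1 / t) * A t"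
    by (simp add: hardy_avg_lborel A_def)
  have "A t = (\<integral>\<^sup>+s. ennreal (f s) * indicator {0..t} s + ennreal (\<phi> (l * s)) * indicator {0..t} s \<partial>lborel)"
    unfolding A_def
  proof (rule nn_integral_lborel_cong_finite[of "{0}"])
    fix s :: real assume "s \<notin> {0}"
    moreover have "ennreal (\<phi> s) = ennreal (f s) + ennreal (\<phi> (l * s))" if "0 < s"
      using that f(2)[of s] nonneg by (subst ennreal_plus[symmetric]) (simp_all add: f_def)
    ultimately show "ennreal (\<phi> s) * indicator {0..t} s
        = ennreal (f s) * indicator {0..t} s + ennreal (\<phi> (l * s)) * indicator {0..t} s"
      by (simp split: split_indicator)
  qed simp
  also have "\<dots> = ?B + ?G"
    by (rule nn_integral_add) measurable
  finally have split: "A t = ?B + ?G" .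
  have "A (l * t) = ennreal \<bar>l\<bar> * (\<integral>\<^sup>+s. ennreal (\<phi> (0 + l * s)) * indicator {0..l * t} (0 + l * s) \<partial>lborel)"
    unfolding A_def using l by (intro nn_integral_real_affine) auto
  also have "(\<integral>\<^sup>+s. ennreal (\<phi> (0 + l * s)) * indicator {0..l * t} (0 + l * s) \<partial>lborel) = ?G"
    using l by (intro nn_integral_cong) (simp split: split_indicator add: zero_le_mult_iff)
  finally have dilate: "A (l * t) = ennreal l * ?G" using l by simp
  have "A (l * t) \<le> (\<integral>\<^sup>+s. ennreal (\<phi> s) * indicator {0..t} s + ennreal (\<phi> t) * indicator {t..l * t} s \<partial>lborel)"
    unfolding A_def
    using monotone_onD[OF dec, of t] t
    by (intro nn_integral_mono) (auto split: split_indicator intro!: ennreal_leI)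
  also have "\<dots> = A t + ennreal (\<phi> t * (l * t - t))"
    unfolding A_def using lt nonneg
    by (subst nn_integral_add) (simp_all add: nn_integral_const_Icc)
  finally have le: "A (l * t) \<le> A t + ennreal (\<phi> t * (l * t - t))" .
  have "A t = ennreal t * hardy_avg \<phi> t"
    using t unfolding avg by (simp add: mult.assoc[symmetric] flip: ennreal_mult)
  \<comment> \<open>From here on all three integrals are real numbers and can be subtracted.\<close>
  then have "A t < \<infinity>" using fin by (simp add: ennreal_mult_less_top)
  then obtain \<alpha> \<beta> \<gamma> where real: "A t = ennreal \<alpha>" "?B = ennreal \<beta>" "?G = ennreal \<gamma>"
    and pos: "0 \<le> \<alpha>" "0 \<le> \<beta>" "0 \<le> \<gamma>"
    unfolding split by (cases ?B; cases ?G) (auto simp flip: ennreal_plus)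
  have "\<alpha> = \<beta> + \<gamma>"
    using split pos unfolding real by (simp flip: ennreal_plus)
  moreover have "l * \<gamma> \<le> \<alpha> + \<phi> t * (l * t - t)"
    using le pos l nonneg[of t] lt unfolding dilate real
    by (simp flip: ennreal_plus ennreal_mult)
  ultimately have key: "(1 - 1 / l) * (\<alpha> - t * \<phi> t) \<le> \<beta>"
    using l by (simp add: field_simps)
  have "hardy_avg \<phi> t = ennreal (\<alpha> / t)"
    using t pos unfolding avg real by (simp flip: ennreal_mult)
  moreover from this have "\<phi> t \<le> \<alpha> / t"
    using le_hardy_avg_decreasing[OF nonneg dec t] t pos by simp
  moreover have "(1 - 1 / l) * (\<alpha> / t - \<phi> t) \<le> \<beta> / t"
    using divide_right_mono[OF key, of t] t by (simp add: field_simps)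
  ultimately have "ennreal (1 - 1 / l) * ennreal \<bar>enn2real (hardy_avg \<phi> t) - \<phi> t\<bar> \<le> ennreal (\<beta> / t)"
    using l t pos by (simp add: ennreal_leI flip: ennreal_mult)
  also have "\<dots> = hardy_avg f t"
    using t pos unfolding hardy_avg_lborel real by (simp flip: ennreal_mult)
  finally show ?thesis unfolding f_def .
qed

text \<open>The measure \<open>ds / s\<close> is invariant under dilations, so the left-hand side is
  the integral of \<open>\<phi> s / s\<close> over \<open>{t..l * t}\<close>, an interval of length
  \<open>(l - 1) * t\<close> on which the integrand is at most \<open>\<phi> t / t\<close>.\<close>

lemma hardy_dual_dilation_difference:
  assumes [measurable]: "\<phi> \<in> borel_measurable borel"
    and nonneg: "\<And>s. 0 \<le> \<phi> s" and dec: "antimono_on {0<..} \<phi>"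
    and fin: "\<And>t. 0 < t \<Longrightarrow> hardy_dual \<phi> t < \<infinity>" and l: "1 < l" and t: "0 < t"
  shows "hardy_dual (\<lambda>s. if 0 < s then \<phi> s - \<phi> (l * s) else 0) t \<le> ennreal (l - 1) * ennreal (\<phi> t)"
proof -
  define f where "f s = (if 0 < s then \<phi> s - \<phi> (l * s) else 0)" for s
  note f = dilation_difference_nonneg_measurable[OF assms(1) dec l, folded f_def[abs_def]]
  note [measurable] = f(1)
  have lt: "t \<le> l * t" using l t by simp
  have "hardy_dual \<phi> (l * t) = ennreal \<bar>l\<bar> *
      (\<integral>\<^sup>+s. ennreal (\<phi> (0 + l * s) / (0 + l * s)) * indicator {l * t..} (0 + l * s) \<partial>lborel)"
    unfolding hardy_dual_lborel using l by (intro nn_integral_real_affine) auto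
  also have "\<dots> = (\<integral>\<^sup>+s. ennreal \<bar>l\<bar> *
      (ennreal (\<phi> (0 + l * s) / (0 + l * s)) * indicator {l * t..} (0 + l * s)) \<partial>lborel)"
    by (rule nn_integral_cmult[symmetric]) measurable
  also have "\<dots> = (\<integral>\<^sup>+s\<in>{t..}. ennreal (\<phi> (l * s) / s) \<partial>lborel)"
  proof (rule nn_integral_cong)
    fix s :: real
    have "ennreal \<bar>l\<bar> * ennreal (\<phi> (l * s) / (l * s)) = ennreal (\<phi> (l * s) / s)"
      using l by (subst ennreal_mult'[symmetric]) auto
    then show "ennreal \<bar>l\<bar> * (ennreal (\<phi> (0 + l * s) / (0 + l * s)) * indicator {l * t..} (0 + l * s))
        = ennreal (\<phi> (l * s) / s) * indicator {t..} s"
      using l by (auto split: split_indicator)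
  qed
  finally have dilate: "hardy_dual \<phi> (l * t) = (\<integral>\<^sup>+s\<in>{t..}. ennreal (\<phi> (l * s) / s) \<partial>lborel)" .
  have "hardy_dual f t + hardy_dual \<phi> (l * t)
      = (\<integral>\<^sup>+s. ennreal (f s / s) * indicator {t..} s + ennreal (\<phi> (l * s) / s) * indicator {t..} s \<partial>lborel)"
    unfolding dilate unfolding hardy_dual_lborel by (rule nn_integral_add[symmetric]) measurable
  also have "\<dots> = hardy_dual \<phi> t"
    unfolding hardy_dual_lborel
  proof (rule nn_integral_cong)
    fix s :: real
    have "ennreal (f s / s) + ennreal (\<phi> (l * s) / s) = ennreal (\<phi> s / s)" if "t \<le> s"
      using that t f(2)[of s] nonneg
      by (subst ennreal_plus[symmetric]) (simp_all add: f_def diff_divide_distrib divide_right_mono)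
    then show "ennreal (f s / s) * indicator {t..} s + ennreal (\<phi> (l * s) / s) * indicator {t..} s
        = ennreal (\<phi> s / s) * indicator {t..} s"
      by (simp split: split_indicator)
  qed
  also have "\<dots> \<le> (\<integral>\<^sup>+s. ennreal (\<phi> t / t) * indicator {t..l * t} s
      + ennreal (\<phi> s / s) * indicator {l * t..} s \<partial>lborel)"
    unfolding hardy_dual_lborel
  proof (rule nn_integral_mono)
    fix s :: real
    have "\<phi> s / s \<le> \<phi> t / t" if "t \<le> s"
      using monotone_onD[OF dec, of t s] that t nonneg by (intro frac_le) auto
    then show "ennreal (\<phi> s / s) * indicator {t..} s
        \<le> ennreal (\<phi> t / t) * indicator {t..l * t} s + ennreal (\<phi> s / s) * indicator {l * t..} s"
      by (auto split: split_indicator intro!: ennreal_leI)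
  qed
  also have "\<dots> = ennreal (\<phi> t / t * (l * t - t)) + hardy_dual \<phi> (l * t)"
    unfolding hardy_dual_lborel using lt nonneg t
    by (subst nn_integral_add) (simp_all add: nn_integral_const_Icc)
  finally have "hardy_dual \<phi> (l * t) + hardy_dual f t
      \<le> hardy_dual \<phi> (l * t) + ennreal (\<phi> t / t * (l * t - t))"
    by (simp only: add.commute)
  then have "hardy_dual f t \<le> ennreal (\<phi> t / t * (l * t - t))"
    using fin[of "l * t"] l t by (auto simp: ennreal_add_left_cancel_le)
  also have "\<phi> t / t * (l * t - t) = (l - 1) * \<phi> t"
    using t by (simp add: field_simps)
  also have "ennreal \<dots> = ennreal (l - 1) * ennreal (\<phi> t)"
    using l nonneg by (intro ennreal_mult) auto
  finally show ?thesis unfolding f_def .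
qed

lemma hardy_diff_bound_of_hardy_avg_le:
  assumes p: "0 < p" and a: "-1 < a" "a < p - 1" and C: "0 \<le> C"
    and le: "\<And>f. nonneg_measurable f \<Longrightarrow>
      weighted_power_integral p a (hardy_avg f) \<le> ennreal C * weighted_power_integral p a (hardy_dual f)"
  shows "hardy_diff_bound p a (C powr (1 / p))"
proof (rule hardy_diff_boundI)
  fix \<phi> :: "real \<Rightarrow> real"
  assume meas [measurable]: "\<phi> \<in> borel_measurable borel" and nonneg: "\<And>s. 0 \<le> \<phi> s"
    and dec: "antimono_on {0<..} \<phi>"
    and fin: "weighted_power_integral p a (\<lambda>t. ennreal (\<phi> t)) < \<infinity>"
  let ?D = "\<lambda>t. ennreal \<bar>enn2real (hardy_avg \<phi> t) - \<phi> t\<bar>"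
  let ?L = "weighted_power_integral p a ?D"
  obtain w where w: "weighted_power_integral p a (\<lambda>t. ennreal (\<phi> t)) = ennreal w" "0 \<le> w"
    using fin by (cases "weighted_power_integral p a (\<lambda>t. ennreal (\<phi> t))") auto
  \<comment> \<open>The factor \<open>l - 1\<close> from \<open>hardy_dual\<close> and the factor
    \<open>1 - 1 / l\<close> from \<open>hardy_avg\<close> vanish at the same rate as
    \<open>l\<close> tends to \<open>1\<close>; their quotient is exactly \<open>l\<close>.\<close>
  have step: "?L \<le> ennreal (l powr p * (C * w))" if l: "1 < l" for l
  proof -
    let ?f = "\<lambda>s. if 0 < s then \<phi> s - \<phi> (l * s) else 0"
    have l': "0 < 1 - 1 / l" using l by simp
    have "ennreal ((1 - 1 / l) powr p) * ?L = weighted_power_integral p a (\<lambda>t. ennreal (1 - 1 / l) * ?D t)"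
      using l' by (intro weighted_power_integral_cmult[symmetric]) measurable
    also have "\<dots> \<le> weighted_power_integral p a (hardy_avg ?f)"
      using p hardy_avg_decreasing_finite[OF meas nonneg dec p a fin]
      by (intro weighted_power_integral_mono hardy_avg_dilation_difference meas nonneg dec l) auto
    also have "\<dots> \<le> ennreal C * weighted_power_integral p a (hardy_dual ?f)"
      by (intro le borel_nonneg_measurable dilation_difference_nonneg_measurable meas dec l)
    also have "weighted_power_integral p a (hardy_dual ?f)
        \<le> weighted_power_integral p a (\<lambda>t. ennreal (l - 1) * ennreal (\<phi> t))"
      using p hardy_dual_decreasing_finite[OF meas nonneg dec p a(1) fin]
      by (intro weighted_power_integral_mono hardy_dual_dilation_difference meas nonneg dec l) auto
    also have "\<dots> = ennreal ((l - 1) powr p) * ennreal w"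
      using l unfolding w(1)[symmetric] by (intro weighted_power_integral_cmult) auto
    finally have "ennreal ((1 - 1 / l) powr p) * ?L \<le> ennreal C * (ennreal ((l - 1) powr p) * ennreal w)"
      by (simp add: mult_left_mono)
    then have "?L \<le> ennreal (1 / (1 - 1 / l) powr p) * (ennreal C * (ennreal ((l - 1) powr p) * ennreal w))"
      using l' by (intro ennreal_cmult_le_imp_le) auto
    also have "\<dots> = ennreal (1 / (1 - 1 / l) powr p * (C * ((l - 1) powr p * w)))"
      by (simp only: ennreal_mult'[symmetric] C powr_ge_zero zero_le_divide_1_iff)
    also have "1 / (1 - 1 / l) powr p * (C * ((l - 1) powr p * w)) = ((l - 1) powr p / (1 - 1 / l) powr p) * (C * w)"
      by simp
    also have "(l - 1) powr p / (1 - 1 / l) powr p = ((l - 1) / (1 - 1 / l)) powr p"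
      using l l' by (simp add: powr_divide)
    also have "(l - 1) / (1 - 1 / l) = l"
      using l by (simp add: field_simps)
    finally show ?thesis .
  qed
  have "(\<lambda>n. (1 + 1 / real (Suc n)) powr p * (C * w)) \<longlonglongrightarrow> (1 + 0) powr p * (C * w)"
    by (intro tendsto_intros tendsto_powr LIMSEQ_Suc[OF lim_1_over_n]) auto
  then have "(\<lambda>n. ennreal ((1 + 1 / real (Suc n)) powr p * (C * w))) \<longlonglongrightarrow> ennreal (C * w)"
    by (intro tendsto_ennrealI) simp
  then have "?L \<le> ennreal (C * w)"
    by (rule LIMSEQ_le_const) (auto intro!: step)
  then show "?L \<le> ennreal ((C powr (1 / p)) powr p) * weighted_power_integral p a (\<lambda>t. ennreal (\<phi> t))"
    using C p w by (simp add: powr_powr ennreal_mult)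
qed

text \<open>Both sharpness claims reduce to this: the lower one with a reciprocal as
  \<open>C\<close>, the upper one at the exponent \<open>p - 2 - a\<close> after inversion.\<close>

lemma hardy_const_powr_le:
  assumes p: "0 < p" and a: "-1 < a" "a < p - 1" and C: "0 \<le> C"
    and le: "\<And>f. nonneg_measurable f \<Longrightarrow>
      weighted_power_integral p a (hardy_avg f) \<le> ennreal C * weighted_power_integral p a (hardy_dual f)"
  shows "hardy_const p a powr p \<le> C"
proof -
  have "hardy_const p a \<le> C powr (1 / p)"
    using hardy_diff_bound_of_hardy_avg_le[OF assms] by (intro hardy_const_le[OF p a]) auto
  then have "hardy_const p a powr p \<le> (C powr (1 / p)) powr p"
    using p hardy_const_pos[OF p a] by (intro powr_mono2) auto
  then show ?thesis using p C by (simp add: powr_powr)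
qed

theorem corollary2p4:
  fixes p a :: real
  assumes "1 \<le> p" and "-1 < a" and "a < p - 1"
  shows "(\<forall>f. nonneg_measurable f \<longrightarrow>
            ennreal (hardy_const p a powr (-p)) * weighted_power_integral p a (hardy_avg f)
              \<le> weighted_power_integral p a (hardy_dual f)
          \<and> weighted_power_integral p a (hardy_dual f)
              \<le> ennreal (hardy_const p (p - 2 - a) powr p) * weighted_power_integral p a (hardy_avg f))
       \<and> (\<forall>C :: ennreal. C > ennreal (hardy_const p a powr (-p)) \<longrightarrow>
            \<not> (\<forall>f. nonneg_measurable f \<longrightarrow>
                  C * weighted_power_integral p a (hardy_avg f)
                    \<le> weighted_power_integral p a (hardy_dual f)))
       \<and> (\<forall>C :: ennreal. C < ennreal (hardy_const p (p - 2 - a) powr p) \<longrightarrow>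
            \<not> (\<forall>f. nonneg_measurable f \<longrightarrow>
                  weighted_power_integral p a (hardy_dual f)
                    \<le> C * weighted_power_integral p a (hardy_avg f)))"
proof (intro conjI allI impI notI)
  have p: "0 < p" using assms by simp
  note a = assms(2,3)
  define a' where "a' = p - 2 - a"
  have a': "-1 < a'" "a' < p - 1" using a unfolding a'_def by auto
  have [simp]: "p - 2 - a' = a" by (simp add: a'_def)
  let ?A = "hardy_const p a" and ?A' = "hardy_const p a'"
  have A: "0 < ?A" "0 < ?A'" using hardy_const_pos p a a' by blast+
  {
    fix f assume f: "nonneg_measurable f"
    have "weighted_power_integral p a (hardy_avg f)
        \<le> ennreal (?A powr p) * weighted_power_integral p a (hardy_dual f)"
      by (rule hardy_avg_le_hardy_dual[OF p a f A(1) hardy_diff_bound_hardy_const[OF p a]])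
    then have "ennreal (?A powr (- p)) * weighted_power_integral p a (hardy_avg f)
        \<le> ennreal (?A powr (- p)) * (ennreal (?A powr p) * weighted_power_integral p a (hardy_dual f))"
      by (rule mult_left_mono) simp
    also have "\<dots> = weighted_power_integral p a (hardy_dual f)"
      using A by (simp add: mult.assoc[symmetric] ennreal_mult[symmetric] powr_add[symmetric])
    finally show "ennreal (?A powr (- p)) * weighted_power_integral p a (hardy_avg f)
        \<le> weighted_power_integral p a (hardy_dual f)" .
    obtain g where g: "g \<in> borel_measurable borel" and nonneg: "\<And>s. 0 \<le> g s"
      and avg: "hardy_avg f = hardy_avg g" and dual: "\<And>t. 0 < t \<Longrightarrow> hardy_dual f t = hardy_dual g t"
      using nonneg_measurable_borel_rep[OF f] by blast
    have "weighted_power_integral p a (hardy_dual f) = weighted_power_integral p a (hardy_dual g)"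
      using dual by (rule weighted_power_integral_cong)
    also have "\<dots> = weighted_power_integral p a' (hardy_avg (inversion g))"
      unfolding a'_def by (rule weighted_power_integral_hardy_dual_inversion[OF g])
    also have "\<dots> \<le> ennreal (?A' powr p) * weighted_power_integral p a' (hardy_dual (inversion g))"
      by (intro hardy_avg_le_hardy_dual p a' A borel_nonneg_measurable measurable_inversion
            inversion_nonneg g nonneg hardy_diff_bound_hardy_const)
    also have "weighted_power_integral p a' (hardy_dual (inversion g)) = weighted_power_integral p a (hardy_avg f)"
      unfolding avg a'_def by (rule weighted_power_integral_hardy_avg_inversion[OF g, symmetric])
    finally show "weighted_power_integral p a (hardy_dual f)
        \<le> ennreal (hardy_const p (p - 2 - a) powr p) * weighted_power_integral p a (hardy_avg f)"
      unfolding a'_def .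
  next
    fix C :: ennreal
    assume less: "ennreal (?A powr (- p)) < C"
      and le: "\<forall>f. nonneg_measurable f \<longrightarrow>
        C * weighted_power_integral p a (hardy_avg f) \<le> weighted_power_integral p a (hardy_dual f)"
    \<comment> \<open>\<open>C\<close> may be infinite. Every smaller constant satisfies the
      assumption too, so density supplies a real one, whose reciprocal can be used.\<close>
    obtain c where c: "ennreal (?A powr (- p)) < c" "c < C" using less dense by blast
    then obtain r where r: "c = ennreal r" "0 \<le> r" by (cases c) auto
    have less_r: "?A powr (- p) < r" using c r by (simp add: ennreal_less_iff)
    then have "0 < r" by (rule le_less_trans[OF powr_ge_zero])
    have "?A powr p \<le> 1 / r"
    proof (rule hardy_const_powr_le[OF p a])
      fix f assume f: "nonneg_measurable f"
      have "ennreal r * weighted_power_integral p a (hardy_avg f) \<le> C * weighted_power_integral p a (hardy_avg f)"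
        using c(2) unfolding r by (intro mult_right_mono) simp_all
      also have "\<dots> \<le> weighted_power_integral p a (hardy_dual f)"
        using le f by simp
      finally show "weighted_power_integral p a (hardy_avg f)
          \<le> ennreal (1 / r) * weighted_power_integral p a (hardy_dual f)"
        using \<open>0 < r\<close> by (rule ennreal_cmult_le_imp_le[rotated])
    qed (use r in simp)
    then have "r \<le> ?A powr (- p)"
      using A \<open>0 < r\<close> by (simp add: powr_minus field_simps)
    then show False using less_r by simp
  next
    fix C :: ennreal
    assume less: "C < ennreal (hardy_const p (p - 2 - a) powr p)"
      and le: "\<forall>f. nonneg_measurable f \<longrightarrow>
        weighted_power_integral p a (hardy_dual f) \<le> C * weighted_power_integral p a (hardy_avg f)"
    obtain r where r: "C = ennreal r" "0 \<le> r" using less by (cases C) auto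
    \<comment> \<open>The assumption at exponent \<open>a\<close> is applied to the inversion of a
      test function; read at exponent \<open>a'\<close>, it has average and dual exchanged, as
      \<open>hardy_const_powr_le\<close> demands.\<close>
    have "?A' powr p \<le> r"
    proof (rule hardy_const_powr_le[OF p a' r(2)])
      fix f assume "nonneg_measurable f"
      then obtain g where g: "g \<in> borel_measurable borel" and nonneg: "\<And>s. 0 \<le> g s"
        and avg: "hardy_avg f = hardy_avg g" and dual: "\<And>t. 0 < t \<Longrightarrow> hardy_dual f t = hardy_dual g t"
        using nonneg_measurable_borel_rep by blast
      have "weighted_power_integral p a' (hardy_avg f) = weighted_power_integral p a (hardy_dual (inversion g))"
        using weighted_power_integral_hardy_avg_inversion[OF g, of p a'] avg by simp
      also have "\<dots> \<le> C * weighted_power_integral p a (hardy_avg (inversion g))"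
        using le g nonneg by (blast intro: borel_nonneg_measurable measurable_inversion inversion_nonneg)
      also have "weighted_power_integral p a (hardy_avg (inversion g)) = weighted_power_integral p a' (hardy_dual g)"
        using weighted_power_integral_hardy_dual_inversion[OF g, of p a'] by simp
      also have "\<dots> = weighted_power_integral p a' (hardy_dual f)"
        using dual by (intro weighted_power_integral_cong) simp
      finally show "weighted_power_integral p a' (hardy_avg f) \<le> ennreal r * weighted_power_integral p a' (hardy_dual f)"
        unfolding r .
    qed
    then show False
      using less r unfolding a'_def by (simp add: ennreal_less_iff)
  }
qed

end
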